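(* Assume the Continuum Hypothesis ($\mathrm{CH}$). Let $X$ be a connected linearly ordered topological space with a first element, with no last element, of countable cofinality and of weight $\mathfrak{c}$. Then the spaces $X^*$ and $[0,\infty)^*$ are homeomorphic.
   Context: For a Tychonoff space $Z$, $\beta Z$ denotes the Čech–Stone compactification of $Z$ and $Z^*=\beta Z\setminus Z$ its Čech–Stone remainder. An ordered space is a linearly ordered set with its order topology; it has countable cofinality if it has a countable cofinal subset. The half line $[0,\infty)$ carries its usual topology. $\mathfrak{c}=2^{\aleph_0}$, and the weight of a space is the least cardinality of a base for its topology. *)

theory Defs
  imports "HOL-Analysis.Analysis"
begin

unbundle cardinal_syntax

section \<open>Cardinals\<close>

text \<open>Cardinals are the well-order relations of \<^theory>\<open>HOL.BNF_Cardinal_Order_Relation\<close>, compared with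
  \<open>=o\<close> and \<open>\<le>o\<close> (across types).\<close>

definition continuum :: "nat set rel" where
  "continuum = |UNIV :: nat set set|"

text \<open>\<^const>\<open>natLeq\<close> represents \<open>\<aleph>\<^sub>0\<close>, so this is \<open>2\<^bsup>\<aleph>\<^sub>0\<^esup> = \<aleph>\<^sub>1\<close>.\<close>

definition Continuum_Hypothesis :: bool where
  "Continuum_Hypothesis \<longleftrightarrow> continuum =o cardSuc natLeq"

definition topology_base :: "'a topology \<Rightarrow> 'a set set \<Rightarrow> bool" where
  "topology_base X B \<longleftrightarrow> openin X = arbitrary union_of (\<lambda>U. U \<in> B)"

definition has_weight :: "'a topology \<Rightarrow> 'k rel \<Rightarrow> bool" where
  "has_weight X \<kappa> \<longleftrightarrow>
     (\<exists>B. topology_base X B \<and> |B| =o \<kappa>) \<and> (\<forall>B. topology_base X B \<longrightarrow> \<kappa> \<le>o |B| )"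

definition countable_cofinality :: "'a::linorder itself \<Rightarrow> bool" where
  "countable_cofinality _ \<longleftrightarrow> (\<exists>C :: 'a set. countable C \<and> (\<forall>x. \<exists>c\<in>C. x \<le> c))"


section \<open>The Cech--Stone compactification and remainder\<close>

text \<open>The compactification is the closure of the canonical image of \<open>X\<close> in the Tychonoff cube
  indexed by all continuous functions from \<open>X\<close> to \<open>[0,1]\<close>. As HOL functions are total, the
  index set contains each such function exactly once by requiring extensionality.\<close>

definition unit_functions :: "'a topology \<Rightarrow> ('a \<Rightarrow> real) set" where
  "unit_functions X = {f \<in> extensional (topspace X). continuous_map X (top_of_set {0..1}) f}"

definition tychonoff_cube :: "'a topology \<Rightarrow> (('a \<Rightarrow> real) \<Rightarrow> real) topology" where
  "tychonoff_cube X = product_topology (\<lambda>_. top_of_set {0..1}) (unit_functions X)"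

definition cech_stone_embedding :: "'a topology \<Rightarrow> 'a \<Rightarrow> ('a \<Rightarrow> real) \<Rightarrow> real" where
  "cech_stone_embedding X x = (\<lambda>f \<in> unit_functions X. f x)"

definition cech_stone :: "'a topology \<Rightarrow> (('a \<Rightarrow> real) \<Rightarrow> real) topology" where
  "cech_stone X =
     subtopology (tychonoff_cube X)
       (tychonoff_cube X closure_of (cech_stone_embedding X ` topspace X))"

definition cech_stone_remainder :: "'a topology \<Rightarrow> (('a \<Rightarrow> real) \<Rightarrow> real) topology" where
  "cech_stone_remainder X =
     subtopology (cech_stone X)
       (topspace (cech_stone X) - cech_stone_embedding X ` topspace X)"

text \<open>For Tychonoff \<open>X\<close>, the defining properties of the compactification: a compact Hausdorff
  space in which \<open>X\<close> is densely embedded and to which every continuous map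
  from \<open>X\<close> to \<open>[0,1]\<close> extends.\<close>

lemma cech_stone_embedding_in_cube:
  "cech_stone_embedding X ` topspace X \<subseteq> topspace (tychonoff_cube X)"
proof -
  have "f x \<in> {0..1}" if "f \<in> unit_functions X" "x \<in> topspace X" for f x
    using that by (force simp: unit_functions_def continuous_map_in_subtopology)
  then show ?thesis
    unfolding tychonoff_cube_def cech_stone_embedding_def topspace_product_topology
    by (intro image_subsetI restrict_PiE_iff[THEN iffD2] ballI) simp
qed

lemma cech_stone_embedding_image:
  "cech_stone_embedding X ` topspace X \<subseteq> topspace (cech_stone X)"
  unfolding cech_stone_def topspace_subtopology
  using cech_stone_embedding_in_cube closure_of_subset by fastforce

lemma compact_space_cech_stone: "compact_space (cech_stone X)"
  unfolding cech_stone_def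
  by (intro compact_space_subtopology closedin_compact_space closedin_closure_of)
     (auto simp: tychonoff_cube_def compact_space_product_topology compact_space_subtopology)

lemma Hausdorff_space_cech_stone: "Hausdorff_space (cech_stone X)"
  by (auto simp: cech_stone_def tychonoff_cube_def
      intro!: Hausdorff_space_subtopology Hausdorff_space_product_topology[THEN iffD2])

lemma dense_cech_stone:
  "cech_stone X closure_of (cech_stone_embedding X ` topspace X) = topspace (cech_stone X)"
  using cech_stone_embedding_image[of X] closure_of_subset_topspace
  unfolding cech_stone_def topspace_subtopology
  by (simp add: closure_of_subtopology inf_absorb2 inf_absorb2[OF closure_of_subset_topspace])

lemma embedding_map_cech_stone:
  assumes "completely_regular_space X" "Hausdorff_space X"
  shows "embedding_map X (cech_stone X) (cech_stone_embedding X)"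
proof -
  have "unit_functions X =
      mspace (submetric (cfunspace X euclidean_metric) {f. f \<in> topspace X \<rightarrow> {0..1}})"
    by (auto simp: unit_functions_def continuous_map_in_subtopology Pi_iff
        intro!: bounded_subset[OF bounded_closed_interval[of 0 "1::real"]])
  then have "embedding_map X (tychonoff_cube X) (cech_stone_embedding X)"
    using completely_regular_space_cube_embedding_explicit[OF assms]
    by (simp add: tychonoff_cube_def cech_stone_embedding_def[abs_def])
  then show ?thesis
    using cech_stone_embedding_image[of X]
    by (simp add: cech_stone_def embedding_map_in_subtopology)
qed

lemma cech_stone_extension:
  assumes "continuous_map X (top_of_set {0..1::real}) f"
  obtains g where "continuous_map (cech_stone X) (top_of_set {0..1}) g"
    and "\<And>x. x \<in> topspace X \<Longrightarrow> g (cech_stone_embedding X x) = f x"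
proof
  let ?f = "restrict f (topspace X)"
  have f: "?f \<in> unit_functions X"
    using continuous_map_eq[OF assms, of ?f] by (simp add: unit_functions_def)
  show "continuous_map (cech_stone X) (top_of_set {0..1}) (\<lambda>p. p ?f)"
    unfolding cech_stone_def tychonoff_cube_def
    by (intro continuous_map_from_subtopology continuous_map_product_projection f)
  show "cech_stone_embedding X x ?f = f x" if "x \<in> topspace X" for x
    using f that by (simp add: cech_stone_embedding_def)
qed

end

(* Cut each of the two rays into compact intervals I_n, J_n, with dense sets D, E of size at most
   continuum containing the end points. A condition is a sequence of finite partial order
   isomorphisms h_n between D in I_n and E in J_n, one for each n, ordered by inclusion for all but
   finitely many n. Countable chains of conditions have upper bounds, there are only continuum many
   sequences of finite subsets of D or E, and under CH a back-and-forth recursion of length omega_1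
   gives a chain whose conditions cover all of them. The chain generates a filter F on pairs of
   points, projecting onto the filters of tails of the two rays. A continuous function on one ray
   oscillates little between the points of suitable finite subsets of the intervals; interpolating
   the values transported by a condition that covers these gives a function on the other
   ray that is close to it along F. Hence a point of one remainder, viewed as a limit functional on
   continuous functions, determines one of the other, which is a homeomorphism. *)

theory Submission
  imports Defs "HOL-Library.Countable_Set_Type"
begin

section \<open>Connected ordered spaces\<close>

text \<open>The segments of \<open>X\<close> may be nonseparable, so they cannot be expected to be
  homeomorphic to compact real intervals, nor \<open>D\<close> to be isomorphic to \<open>E\<close>
  on a segment. This is why conditions are finite on each segment. Ordering sequences of them modulo
  finitely many segments restores upper bounds for countable chains: a union of infinitely many
  finite maps need not be finite, but a diagonal choice takes each coordinate from a single member
  of the chain. CH lets every stage of the recursion see only countably many earlier ones, while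
  there are still as many stages as tasks. Finite conditions suffice because a continuous function
  on a compact segment is controlled up to \<epsilon> by finitely many points. The weight bounds the
  size of \<open>D\<close>, which takes one point from each basic open set. Since functions are
  transferred only up to \<epsilon>, the value of the new functional at a function is found as a
  common point of pairwise intersecting real intervals; no map between the two rays is
  constructed.\<close>

lemma open_contains_convex_nhd:
  fixes x :: "'a::linorder_topology"
  assumes "open S" "x \<in> S"
  obtains W where "open W" "x \<in> W" "W \<subseteq> S" "\<And>y z. y \<in> W \<Longrightarrow> z \<in> W \<Longrightarrow> {y..z} \<subseteq> W"
proof -
  \<comment> \<open>\<open>U\<close> is downward closed and controls the points above
    \<open>x\<close>; its counterpart \<open>V\<close> is upward closed and controls those below.
    Hence the intersection is convex and lies in \<open>S\<close>. The case splits treat an extreme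
    point \<open>x\<close>, beyond which there is nothing to control.\<close>
  obtain U where U: "open U" "x \<in> U" "U \<inter> {x..} \<subseteq> S" "\<And>y z. z \<in> U \<Longrightarrow> y \<le> z \<Longrightarrow> y \<in> U"
  proof (cases "\<exists>y. x < y")
    case True
    then obtain b where "b > x" "{x..<b} \<subseteq> S"
      using open_right[OF assms] by blast
    then show ?thesis
      by (intro that[of "{..<b}"]) auto
  next
    case False
    then have "{x..} = {x}" by (auto simp: not_less intro: antisym)
    then show ?thesis
      using assms by (intro that[of UNIV]) auto
  qed
  obtain V where V: "open V" "x \<in> V" "V \<inter> {..x} \<subseteq> S" "\<And>y z. y \<in> V \<Longrightarrow> y \<le> z \<Longrightarrow> z \<in> V"
  proof (cases "\<exists>y. y < x")
    case True
    then obtain b where "b < x" "{b<..x} \<subseteq> S"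
      using open_left[OF assms] by blast
    then show ?thesis
      by (intro that[of "{b<..}"]) auto
  next
    case False
    then have "{..x} = {x}" by (auto simp: not_less intro: antisym)
    then show ?thesis
      using assms by (intro that[of UNIV]) auto
  qed
  show ?thesis
  proof
    show "open (U \<inter> V)" "x \<in> U \<inter> V" using U V by auto
    show "U \<inter> V \<subseteq> S"
    proof
      fix y assume "y \<in> U \<inter> V"
      then show "y \<in> S" using U(3) V(3) by (cases "x \<le> y") auto
    qed
    show "{y..z} \<subseteq> U \<inter> V" if "y \<in> U \<inter> V" "z \<in> U \<inter> V" for y z
      using that U(4) V(4) by (meson IntD1 IntD2 IntI atLeastAtMost_iff subsetI)
  qed
qed

text \<open>Clamping to the interval by \<open>max u (min v x)\<close> is continuous and maps
  \<open>S\<close> onto \<open>{u..v}\<close>.\<close>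

lemma connected_Icc_of_connected:
  fixes u v :: "'a::linorder_topology"
  assumes "connected S" "{u..v} \<subseteq> S"
  shows "connected {u..v}"
proof (cases "u \<le> v")
  case True
  have "(\<lambda>x. max u (min v x)) ` S = {u..v}"
  proof (intro equalityI subsetI)
    fix y assume "y \<in> {u..v}"
    then have "y = max u (min v y)" "y \<in> S" using assms by auto
    then show "y \<in> (\<lambda>x. max u (min v x)) ` S" by blast
  qed (use True in auto)
  moreover have "connected ((\<lambda>x. max u (min v x)) ` S)"
    by (intro connected_continuous_image assms continuous_intros)
  ultimately show ?thesis by simp
qed auto

text \<open>An induction over intervals that takes the place of supremum arguments. Symmetrising
  \<open>P\<close> gives an equivalence relation on \<open>{u..v}\<close> with relatively open
  classes, so connectedness leaves only one class. Transitivity comes from \<open>glue\<close> when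
  the middle point lies between the others and from \<open>sub\<close> when it does not.\<close>

lemma connected_Icc_induct:
  fixes P :: "'a::linorder_topology \<Rightarrow> 'a \<Rightarrow> bool"
  assumes conn: "connected {u..v}" and "u \<le> v"
    and sub: "\<And>x y x' y'. \<lbrakk>P x y; u \<le> x; x \<le> x'; x' \<le> y'; y' \<le> y; y \<le> v\<rbrakk> \<Longrightarrow> P x' y'"
    and glue: "\<And>x y z. \<lbrakk>P x y; P y z; u \<le> x; x \<le> y; y \<le> z; z \<le> v\<rbrakk> \<Longrightarrow> P x z"
    and nhd: "\<And>x. u \<le> x \<Longrightarrow> x \<le> v \<Longrightarrow>
      \<exists>W. open W \<and> x \<in> W \<and> (\<forall>y z. y \<in> W \<longrightarrow> z \<in> W \<longrightarrow> u \<le> y \<longrightarrow> y \<le> z \<longrightarrow> z \<le> v \<longrightarrow> P y z)"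
  shows "P u v"
proof -
  define R where "R x y = P (min x y) (max x y)" for x y
  have Ple: "R x y \<Longrightarrow> x \<le> y \<Longrightarrow> P x y" "R x y \<Longrightarrow> y \<le> x \<Longrightarrow> P y x" for x y
    by (auto simp: R_def min_def max_def split: if_splits)
  have tr: "R x z" if "R x y" "R y z" "x \<in> {u..v}" "y \<in> {u..v}" "z \<in> {u..v}" for x y z
  proof -
    have *: "P x z" if "R x y" "R y z" "x \<in> {u..v}" "y \<in> {u..v}" "z \<in> {u..v}" "x \<le> z" for x y z
    proof -
      consider "y \<le> x" | "x \<le> y" "y \<le> z" | "z \<le> y" by force
      then show ?thesis
      proof cases
        case 1
        then have "P y z" using that Ple by force
        then show ?thesis using sub[of y z x z] 1 that by auto
      next
        case 2
        then show ?thesis using glue[of x y z] that Ple by auto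
      next
        case 3
        then have "P x y" using that Ple by force
        then show ?thesis using sub[of x y x z] 3 that by auto
      qed
    qed
    have sym: "R y x" if "R x y" for x y
      using that by (simp add: R_def min.commute max.commute)
    show ?thesis
    proof (cases "x \<le> z")
      case True
      then show ?thesis using *[of x y z] that by (simp add: R_def)
    next
      case False
      then show ?thesis using *[of z y x] sym that by (simp add: R_def)
    qed
  qed
  have "R u v"
  proof (rule connected_equivalence_relation[OF conn])
    show "u \<in> {u..v}" "v \<in> {u..v}" using \<open>u \<le> v\<close> by auto
    show "R y x" if "R x y" for x y
      using that by (simp add: R_def min.commute max.commute)
    show "R x z" if "R x y" "R y z" "x \<in> {u..v}" "y \<in> {u..v}" "z \<in> {u..v}" for x y z
      using tr that by blast
    fix x assume x: "x \<in> {u..v}"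
    then obtain W where W: "open W" "x \<in> W"
      "\<And>y z. y \<in> W \<Longrightarrow> z \<in> W \<Longrightarrow> u \<le> y \<Longrightarrow> y \<le> z \<Longrightarrow> z \<le> v \<Longrightarrow> P y z"
      using nhd[of x] by auto
    have RW: "R x y" if "y \<in> {u..v} \<inter> W" for y
      unfolding R_def using that x W(2)
      by (intro W(3)) (auto simp: min_def max_def)
    then show "\<exists>T. openin (top_of_set {u..v}) T \<and> x \<in> T \<and> (\<forall>y\<in>T. R x y)"
      using x W(1,2) RW by (intro exI[of _ "{u..v} \<inter> W"] conjI ballI openin_open_Int) auto
  qed
  then show ?thesis
    using \<open>u \<le> v\<close> by (simp add: R_def)
qed

text \<open>Having a finite subcover passes to subintervals, survives gluing, and holds on a convex
  neighbourhood contained in one member of the cover, so interval induction applies.\<close>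

lemma compact_Icc_of_connected:
  fixes u v :: "'a::linorder_topology"
  assumes "connected {u..v}"
  shows "compact {u..v}"
proof (cases "u \<le> v")
  case True
  show ?thesis
    unfolding compact_eq_Heine_Borel
  proof (intro allI impI, elim conjE)
    fix C :: "'a set set" assume C: "\<forall>c\<in>C. open c" "{u..v} \<subseteq> \<Union>C"
    let ?P = "\<lambda>x y. \<exists>C'. C' \<subseteq> C \<and> finite C' \<and> {x..y} \<subseteq> \<Union>C'"
    show "?P u v"
    proof (rule connected_Icc_induct[where P = ?P, OF assms True])
      fix x y x' y' assume "?P x y" "x \<le> x'" "y' \<le> y"
      then obtain C' where "C' \<subseteq> C" "finite C'" "{x..y} \<subseteq> \<Union>C'" by blast
      moreover from this(3) have "{x'..y'} \<subseteq> \<Union>C'" by (rule order_trans[rotated]) (use \<open>x \<le> x'\<close> \<open>y' \<le> y\<close> in auto)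
      ultimately show "?P x' y'" by (intro exI[of _ C'] conjI)
    next
      fix x y z assume "?P x y" "?P y z" "x \<le> y" "y \<le> z"
      then obtain C1 C2 where "C1 \<subseteq> C" "finite C1" "{x..y} \<subseteq> \<Union>C1" "C2 \<subseteq> C" "finite C2" "{y..z} \<subseteq> \<Union>C2"
        by blast
      moreover have "{x..z} \<subseteq> {x..y} \<union> {y..z}" by auto
      ultimately show "?P x z" by (intro exI[of _ "C1 \<union> C2"] conjI) (simp_all, blast)
    next
      fix x assume "u \<le> x" "x \<le> v"
      then obtain c where c: "c \<in> C" "x \<in> c" using C by auto
      then obtain W where W: "open W" "x \<in> W" "W \<subseteq> c" "\<And>y z. y \<in> W \<Longrightarrow> z \<in> W \<Longrightarrow> {y..z} \<subseteq> W"
        using open_contains_convex_nhd[of c x] C(1) by metis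
      show "\<exists>W. open W \<and> x \<in> W \<and>
        (\<forall>y z. y \<in> W \<longrightarrow> z \<in> W \<longrightarrow> u \<le> y \<longrightarrow> y \<le> z \<longrightarrow> z \<le> v \<longrightarrow> ?P y z)"
      proof (intro exI[of _ W] conjI W allI impI)
        fix y z assume "y \<in> W" "z \<in> W"
        then have "{y..z} \<subseteq> \<Union>{c}" using W(3) W(4)[of y z] by auto
        then show "?P y z" using c(1) by (intro exI[of _ "{c}"]) auto
      qed
    qed
  qed
qed auto

lemma Hausdorff_space_euclidean_t2: "Hausdorff_space (euclidean :: 'a::t2_space topology)"
  unfolding Hausdorff_space_def
proof (intro allI impI, elim conjE)
  fix x y :: 'a assume "x \<noteq> y"
  then obtain U V where UV: "open U" "open V" "x \<in> U" "y \<in> V" "U \<inter> V = {}"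
    by (rule hausdorff[THEN exE]) (elim exE conjE)
  show "\<exists>U V. openin euclidean U \<and> openin euclidean V \<and> x \<in> U \<and> y \<in> V \<and> disjnt U V"
  proof (intro exI conjI)
    show "openin euclidean U" "openin euclidean V" "x \<in> U" "y \<in> V" "disjnt U V"
      using UV by (simp_all add: disjnt_def)
  qed
qed

text \<open>The interval is compact Hausdorff, hence normal. Composing with the clamping map extends
  the Urysohn function by constants to the whole order.\<close>

lemma connected_Icc_Urysohn:
  fixes u v :: "'a::linorder_topology"
  assumes "connected {u..v}" "u < v"
  obtains f :: "'a \<Rightarrow> real" where "continuous_on UNIV f" "\<And>x. f x \<in> {0..1}"
    "\<And>x. x \<le> u \<Longrightarrow> f x = 0" "\<And>x. v \<le> x \<Longrightarrow> f x = 1"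
proof -
  have "compact_space (top_of_set {u..v})"
    using compact_Icc_of_connected[OF assms(1)] by (intro compact_space_subtopology) simp
  moreover have "Hausdorff_space (top_of_set {u..v})"
    by (intro Hausdorff_space_subtopology Hausdorff_space_euclidean_t2)
  ultimately have "normal_space (top_of_set {u..v})"
    by (intro compact_Hausdorff_or_regular_imp_normal_space disjI1)
  moreover have "closedin (top_of_set {u..v}) {u}" "closedin (top_of_set {u..v}) {v}"
    using \<open>u < v\<close> by (auto intro: closed_subset)
  moreover have "disjnt {u} {v}" using \<open>u < v\<close> by auto
  ultimately obtain g where g: "continuous_map (top_of_set {u..v}) (top_of_set {0..1::real}) g"
    "g ` {u} \<subseteq> {0}" "g ` {v} \<subseteq> {1}"
    by (rule Urysohn_lemma[where a = 0 and b = 1]) (simp, rule that)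
  show ?thesis
  proof
    let ?c = "\<lambda>x. max u (min v x)"
    have g': "continuous_on {u..v} g" "\<And>x. x \<in> {u..v} \<Longrightarrow> g x \<in> {0..1}"
      using g(1) by (auto simp: continuous_map_in_subtopology)
    have c: "?c x \<in> {u..v}" for x using \<open>u < v\<close> by auto
    have "continuous_on UNIV ?c" by (intro continuous_intros)
    then show "continuous_on UNIV (\<lambda>x. g (?c x))"
      by (rule continuous_on_compose2[OF g'(1)]) (use c in blast)
    show "g (?c x) \<in> {0..1}" for x using g'(2)[OF c] .
    show "g (?c x) = 0" if "x \<le> u" for x
      using that g(2) \<open>u < v\<close> by (auto simp: min_def max_def)
    show "g (?c x) = 1" if "v \<le> x" for x
      using that g(3) \<open>u < v\<close> by (auto simp: min_def max_def)
  qed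
qed

section \<open>Remainders as limit points along the tails\<close>

lemma topspace_tychonoff_cube:
  "topspace (tychonoff_cube X) = (\<Pi>\<^sub>E f\<in>unit_functions X. {0..1})"
  by (simp add: tychonoff_cube_def)

lemma unit_functionsD:
  assumes "f \<in> unit_functions X" "x \<in> topspace X"
  shows "0 \<le> f x" "f x \<le> 1"
  using assms by (force simp: unit_functions_def continuous_map_in_subtopology)+

lemma restrict_mem_unit_functions:
  assumes "continuous_on S f" "\<And>x. x \<in> S \<Longrightarrow> f x \<in> {0..1}"
  shows "restrict f S \<in> unit_functions (top_of_set S)"
proof -
  have "continuous_on S (restrict f S)"
    using assms(1) by (rule continuous_on_eq) simp
  then show ?thesis
    using assms(2) by (auto simp: unit_functions_def continuous_map_in_subtopology)
qed

lemma cube_box_open: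
  assumes "finite Fs" "Fs \<subseteq> unit_functions X"
  shows "openin (tychonoff_cube X) {q \<in> topspace (tychonoff_cube X). \<forall>f\<in>Fs. \<bar>p f - q f\<bar> < \<epsilon>}"
  using assms
proof (induction Fs rule: finite_induct)
  case (insert f Fs)
  have "continuous_map (tychonoff_cube X) euclidean (\<lambda>q. q f)"
    using continuous_map_product_projection[of f "unit_functions X" "\<lambda>_. top_of_set {0..1::real}"]
      insert.prems
    by (auto simp: tychonoff_cube_def continuous_map_in_subtopology)
  then have "openin (tychonoff_cube X) {q \<in> topspace (tychonoff_cube X). q f \<in> ball (p f) \<epsilon>}"
    by (rule openin_continuous_map_preimage) simp
  then have "openin (tychonoff_cube X) ({q \<in> topspace (tychonoff_cube X). q f \<in> ball (p f) \<epsilon>} \<inter>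
      {q \<in> topspace (tychonoff_cube X). \<forall>f\<in>Fs. \<bar>p f - q f\<bar> < \<epsilon>})"
    using insert by (intro openin_Int) auto
  also have "\<dots> = {q \<in> topspace (tychonoff_cube X). \<forall>f\<in>insert f Fs. \<bar>p f - q f\<bar> < \<epsilon>}"
    by (auto simp: dist_real_def)
  finally show ?case .
qed simp

lemma cube_open_contains_box:
  assumes "openin (tychonoff_cube X) W" "p \<in> W"
  obtains Fs \<epsilon> where "finite Fs" "Fs \<subseteq> unit_functions X" "0 < \<epsilon>"
    "{q \<in> topspace (tychonoff_cube X). \<forall>f\<in>Fs. \<bar>p f - q f\<bar> < \<epsilon>} \<subseteq> W"
proof -
  let ?U = "unit_functions X"
  obtain V where V: "finite {f \<in> ?U. V f \<noteq> {0..1}}"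
      "\<And>f. f \<in> ?U \<Longrightarrow> openin (top_of_set {0..1::real}) (V f)" "p \<in> Pi\<^sub>E ?U V" "Pi\<^sub>E ?U V \<subseteq> W"
    using assms unfolding tychonoff_cube_def openin_product_topology_alt by (auto; metis)
  let ?Fs = "{f \<in> ?U. V f \<noteq> {0..1}}"
  have "\<exists>e>0. \<forall>t\<in>{0..1}. \<bar>p f - t\<bar> < e \<longrightarrow> t \<in> V f" if "f \<in> ?U" for f
  proof -
    have "p f \<in> V f" using V(3) that by auto
    then show ?thesis
      using V(2)[OF that] unfolding openin_euclidean_subtopology_iff dist_real_def
      by (metis abs_minus_commute)
  qed
  then obtain e where e: "\<And>f. f \<in> ?U \<Longrightarrow> 0 < e f"
    "\<And>f t. \<lbrakk>f \<in> ?U; t \<in> {0..1}; \<bar>p f - t\<bar> < e f\<rbrakk> \<Longrightarrow> t \<in> V f"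
    by metis
  \<comment> \<open>Only finitely many coordinates are restricted, so a minimum serves them all; the
    1 keeps it well defined when there are none.\<close>
  define \<epsilon> where "\<epsilon> = Min (insert 1 (e ` ?Fs))"
  have \<epsilon>: "0 < \<epsilon>" "\<And>f. f \<in> ?Fs \<Longrightarrow> \<epsilon> \<le> e f"
    unfolding \<epsilon>_def using V(1) e(1) by (auto simp: Min_gr_iff)
  have "{q \<in> topspace (tychonoff_cube X). \<forall>f\<in>?Fs. \<bar>p f - q f\<bar> < \<epsilon>} \<subseteq> Pi\<^sub>E ?U V"
  proof (clarsimp simp: topspace_tychonoff_cube)
    fix q assume q: "q \<in> (\<Pi>\<^sub>E f\<in>?U. {0..1::real})" and *: "\<forall>f. f \<in> ?U \<and> V f \<noteq> {0..1} \<longrightarrow> \<bar>p f - q f\<bar> < \<epsilon>"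
    show "q \<in> Pi\<^sub>E ?U V"
    proof (rule PiE_I)
      fix f assume f: "f \<in> ?U"
      then have "q f \<in> {0..1}" using q by blast
      then show "q f \<in> V f"
        using e(2)[OF f, of "q f"] \<epsilon>(2)[of f] * f by (cases "V f = {0..1}") force+
    qed (use q in auto)
  qed
  then show ?thesis
    using that[of ?Fs \<epsilon>] V(1,4) \<epsilon>(1) by auto
qed

text \<open>The cluster points of the canonical embedding along \<open>at_top\<close>, written out
  with basic boxes. This presents a remainder point as a functional that finitely many functions at
  a time approximate by evaluation far out.\<close>

definition tail_limits :: "'a::linorder_topology set \<Rightarrow> (('a \<Rightarrow> real) \<Rightarrow> real) set" where
  "tail_limits S = {p \<in> topspace (tychonoff_cube (top_of_set S)).
     \<forall>Fs \<epsilon>. finite Fs \<longrightarrow> Fs \<subseteq> unit_functions (top_of_set S) \<longrightarrow> 0 < \<epsilon> \<longrightarrow>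
       (\<exists>\<^sub>F x in at_top. \<forall>f\<in>Fs. \<bar>p f - f x\<bar> < \<epsilon>)}"

lemma tail_limitsD:
  assumes "p \<in> tail_limits S" "finite Fs" "Fs \<subseteq> unit_functions (top_of_set S)" "0 < \<epsilon>"
  shows "\<exists>\<^sub>F x in at_top. \<forall>f\<in>Fs. \<bar>p f - f x\<bar> < \<epsilon>"
  using assms by (auto simp: tail_limits_def)

lemma frequently_at_top_linorder:
  fixes P :: "'a::linorder \<Rightarrow> bool"
  shows "(\<exists>\<^sub>F x in at_top. P x) \<longleftrightarrow> (\<forall>N. \<exists>x\<ge>N. P x)"
  by (auto simp: frequently_def eventually_at_top_linorder)

text \<open>Initial intervals are compact, so their images are closed and a remainder point is
  approached only from arbitrarily far out. Conversely, an embedded point \<open>x\<close> is no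
  tail limit: a Urysohn function that is 0 up to \<open>x\<close> and 1 from a later point on
  separates it from the tail.\<close>

lemma cech_stone_remainder_ray:
  fixes a :: "'a::linorder_topology"
  assumes conn: "connected {a..}" and unb: "\<And>x::'a. \<exists>y. x < y"
  shows "cech_stone_remainder (top_of_set {a..}) =
    subtopology (tychonoff_cube (top_of_set {a..})) (tail_limits {a..})"
proof -
  let ?X = "top_of_set {a..}" and ?T = "tychonoff_cube (top_of_set {a..})"
  let ?e = "cech_stone_embedding ?X" and ?U = "unit_functions ?X"
  let ?C = "?T closure_of (?e ` topspace ?X)"
  have eU: "?e x f = f x" if "f \<in> ?U" for f x
    using that by (simp add: cech_stone_embedding_def)
  have etop: "?e x \<in> topspace ?T" if "a \<le> x" for x
    using that cech_stone_embedding_in_cube[of ?X] by auto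
  have conn': "connected {u..v}" if "a \<le> u" for u v
    using that by (intro connected_Icc_of_connected[OF conn]) auto
  have "?C \<subseteq> topspace ?T" by (rule closure_of_subset_topspace)
  have contr: "?e x \<notin> tail_limits {a..}" if "a \<le> x" for x
  proof
    assume p: "?e x \<in> tail_limits {a..}"
    obtain y where "x < y" using unb by blast
    then obtain f :: "'a \<Rightarrow> real" where f: "continuous_on UNIV f" "\<And>x. f x \<in> {0..1}"
        "\<And>z. z \<le> x \<Longrightarrow> f z = 0" "\<And>z. y \<le> z \<Longrightarrow> f z = 1"
      using connected_Icc_Urysohn[OF conn'[OF \<open>a \<le> x\<close>]] by metis
    have fU: "restrict f {a..} \<in> ?U"
      using f(1,2) by (intro restrict_mem_unit_functions) (use continuous_on_subset in blast)+
    from tail_limitsD[OF p, of "{restrict f {a..}}" 1] fU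
    have "\<exists>\<^sub>F z in at_top. \<bar>?e x (restrict f {a..}) - restrict f {a..} z\<bar> < 1"
      by simp
    then obtain z where "z \<ge> y" "\<bar>?e x (restrict f {a..}) - restrict f {a..} z\<bar> < 1"
      unfolding frequently_at_top_linorder by blast
    moreover have "z \<ge> a" using \<open>z \<ge> y\<close> \<open>x < y\<close> \<open>a \<le> x\<close> by auto
    ultimately show False using eU[OF fU, of x] f(3)[of x] f(4)[of z] \<open>a \<le> x\<close> by simp
  qed
  have "?C - ?e ` {a..} = tail_limits {a..}"
  proof (intro equalityI subsetI)
    fix p assume "p \<in> ?C - ?e ` {a..}"
    then have p: "p \<in> ?C" "p \<notin> ?e ` {a..}" "p \<in> topspace ?T"
      using \<open>?C \<subseteq> topspace ?T\<close> by auto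
    show "p \<in> tail_limits {a..}"
      unfolding tail_limits_def frequently_at_top_linorder
    proof (intro CollectI conjI allI impI p(3))
      fix Fs \<epsilon> N assume Fs: "finite Fs" "Fs \<subseteq> ?U" "0 < (\<epsilon>::real)"
      have "compactin ?X {a..max a N}"
        using compact_Icc_of_connected[OF conn'[of a]] by (simp add: compactin_subtopology)
      moreover have "continuous_map ?X ?T ?e"
        unfolding tychonoff_cube_def cech_stone_embedding_def
        by (auto simp: continuous_map_componentwise unit_functions_def)
      ultimately have "compactin ?T (?e ` {a..max a N})"
        by (rule image_compactin)
      moreover have "Hausdorff_space ?T"
        unfolding tychonoff_cube_def
        by (auto intro!: Hausdorff_space_product_topology[THEN iffD2] Hausdorff_space_subtopology)
      ultimately have "closedin ?T (?e ` {a..max a N})"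
        by (rule compactin_imp_closedin[rotated])
      \<comment> \<open>Removing the compact image of the initial interval forces the approximating
        point beyond \<open>N\<close>; \<open>max a N\<close> covers an \<open>N\<close> below the
        start of the ray.\<close>
      then have "openin ?T ({q \<in> topspace ?T. \<forall>f\<in>Fs. \<bar>p f - q f\<bar> < \<epsilon>} - ?e ` {a..max a N})"
        by (intro openin_diff cube_box_open Fs)
      moreover have "p \<in> {q \<in> topspace ?T. \<forall>f\<in>Fs. \<bar>p f - q f\<bar> < \<epsilon>} - ?e ` {a..max a N}"
        using p Fs by auto
      ultimately have "\<exists>y. y \<in> ?e ` topspace ?X \<and>
          y \<in> {q \<in> topspace ?T. \<forall>f\<in>Fs. \<bar>p f - q f\<bar> < \<epsilon>} - ?e ` {a..max a N}"
        using p(1)[unfolded in_closure_of] by (elim conjE allE impE) (intro conjI)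
      then obtain x where "x \<in> topspace ?X"
          and xW: "?e x \<in> {q \<in> topspace ?T. \<forall>f\<in>Fs. \<bar>p f - q f\<bar> < \<epsilon>} - ?e ` {a..max a N}"
        by blast
      then have x: "a \<le> x" "x \<notin> {a..max a N}" "\<forall>f\<in>Fs. \<bar>p f - ?e x f\<bar> < \<epsilon>"
        using imageI[of x "{a..max a N}" ?e] by (simp, blast+)
      then have "N \<le> x" by (auto simp: le_max_iff_disj)
      moreover have "\<forall>f\<in>Fs. \<bar>p f - f x\<bar> < \<epsilon>" using x(3) eU Fs(2) by (metis subsetD)
      ultimately show "\<exists>x\<ge>N. \<forall>f\<in>Fs. \<bar>p f - f x\<bar> < \<epsilon>" by blast
    qed
  next
    fix p assume p: "p \<in> tail_limits {a..}"
    then have ptop: "p \<in> topspace ?T" by (simp add: tail_limits_def)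
    have "p \<in> ?C"
      unfolding in_closure_of
    proof (intro conjI ptop allI impI, elim conjE)
      fix W assume W: "p \<in> W" "openin ?T W"
      obtain Fs \<epsilon> where Fs: "finite Fs" "Fs \<subseteq> ?U" "0 < \<epsilon>"
          "{q \<in> topspace ?T. \<forall>f\<in>Fs. \<bar>p f - q f\<bar> < \<epsilon>} \<subseteq> W"
        by (rule cube_open_contains_box[OF W(2,1)])
      obtain x where x: "x \<ge> a" "\<forall>f\<in>Fs. \<bar>p f - f x\<bar> < \<epsilon>"
        using tail_limitsD[OF p Fs(1-3)] unfolding frequently_at_top_linorder by blast
      have "\<forall>f\<in>Fs. \<bar>p f - ?e x f\<bar> < \<epsilon>" using x(2) eU Fs(2) by (metis subsetD)
      then have "?e x \<in> W" using etop[OF x(1)] Fs(4) by blast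
      then show "\<exists>y. y \<in> ?e ` topspace ?X \<and> y \<in> W" using x(1) by auto
    qed
    then show "p \<in> ?C - ?e ` {a..}" using contr p by auto
  qed
  then have "?C \<inter> (topspace ?T \<inter> ?C - ?e ` {a..}) = tail_limits {a..}"
    using \<open>?C \<subseteq> topspace ?T\<close> by blast
  then show ?thesis
    unfolding cech_stone_remainder_def cech_stone_def subtopology_subtopology topspace_subtopology
    by simp
qed

section \<open>Transfer of limit points along a filter\<close>

text \<open>The filter plays the role of an ultraproduct isomorphism: a limit point of the tails of one
  space is linked to one of the other when the two agree on every pair of functions that are close
  along the filter.\<close>

definition linked ::
  "('a \<times> 'b) filter \<Rightarrow> ('a \<Rightarrow> real) set \<Rightarrow> ('b \<Rightarrow> real) set \<Rightarrow>
    (('a \<Rightarrow> real) \<Rightarrow> real) \<Rightarrow> (('b \<Rightarrow> real) \<Rightarrow> real) \<Rightarrow> bool" where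
  "linked F U V p q \<longleftrightarrow> (\<forall>f\<in>U. \<forall>g\<in>V. \<forall>\<epsilon>.
     (\<forall>\<^sub>F z in F. \<bar>f (fst z) - g (snd z)\<bar> \<le> \<epsilon>) \<longrightarrow> \<bar>p f - q g\<bar> \<le> \<epsilon>)"

lemma linkedD:
  assumes "linked F U V p q" "f \<in> U" "g \<in> V" "\<forall>\<^sub>F z in F. \<bar>f (fst z) - g (snd z)\<bar> \<le> \<epsilon>"
  shows "\<bar>p f - q g\<bar> \<le> \<epsilon>"
  using assms by (auto simp: linked_def)

lemma linked_swap: "linked (filtermap prod.swap F) V U q p \<longleftrightarrow> linked F U V p q"
  by (auto simp: linked_def eventually_filtermap abs_minus_commute)

text \<open>The functions in \<open>V\<close> are the ones approximated, by functions in
  \<open>U\<close>; this is the direction that carries a functional on \<open>U\<close> to one on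
  \<open>V\<close>.\<close>

definition approximates :: "('a \<times> 'b) filter \<Rightarrow> ('a \<Rightarrow> real) set \<Rightarrow> ('b \<Rightarrow> real) set \<Rightarrow> bool" where
  "approximates F U V \<longleftrightarrow>
     (\<forall>g\<in>V. \<forall>\<epsilon>>0. \<exists>f\<in>U. \<forall>\<^sub>F z in F. \<bar>f (fst z) - g (snd z)\<bar> \<le> \<epsilon>)"

lemma approximatesD:
  assumes "approximates F U V" "g \<in> V" "0 < \<epsilon>"
  obtains f where "f \<in> U" "\<forall>\<^sub>F z in F. \<bar>f (fst z) - g (snd z)\<bar> \<le> \<epsilon>"
  using assms by (auto simp: approximates_def)

abbreviation units_on :: "'a::topological_space set \<Rightarrow> ('a \<Rightarrow> real) set" where
  "units_on S \<equiv> unit_functions (top_of_set S)"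

text \<open>Evaluation at one far point \<open>x\<close> is close to \<open>p\<close> at both
  functions at once, so \<open>p\<close> inherits the bound that holds there.\<close>

lemma tail_limits_le:
  assumes p: "p \<in> tail_limits S" and fg: "f \<in> units_on S" "g \<in> units_on S"
    and ev: "\<forall>\<^sub>F x in at_top. \<bar>f x - g x\<bar> \<le> \<epsilon>"
  shows "\<bar>p f - p g\<bar> \<le> \<epsilon>"
proof (rule field_le_epsilon)
  fix e :: real assume "0 < e"
  then have "\<exists>\<^sub>F x in at_top. \<forall>h\<in>{f, g}. \<bar>p h - h x\<bar> < e / 2"
    using fg by (intro tail_limitsD[OF p]) auto
  then have "\<exists>\<^sub>F x in at_top. (\<forall>h\<in>{f, g}. \<bar>p h - h x\<bar> < e / 2) \<and> \<bar>f x - g x\<bar> \<le> \<epsilon>"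
    using ev by (rule frequently_eventually_frequently)
  then obtain x where "\<bar>p f - f x\<bar> < e / 2" "\<bar>p g - g x\<bar> < e / 2" "\<bar>f x - g x\<bar> \<le> \<epsilon>"
    using frequently_ex by fastforce
  then show "\<bar>p f - p g\<bar> \<le> \<epsilon> + e" by linarith
qed

text \<open>A linked \<open>q\<close> must have \<open>q g\<close> in the interval of radius
  \<epsilon> around \<open>p f\<close> for every \<open>f\<close> that is \<epsilon>-close to
  \<open>g\<close> along \<open>F\<close>. By \<open>le\<close> these intervals intersect pairwise,
  so the supremum of their left end points, collected in \<open>A g\<close>, lies in all of
  them.\<close>

lemma linked_exists:
  fixes S :: "'a::linorder_topology set" and T :: "'b::linorder_topology set"
  assumes fst: "filtermap fst F = at_top" and snd: "filtermap snd F = at_top"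
    and approx: "approximates F (units_on S) (units_on T)"
    and tailT: "\<forall>\<^sub>F y in at_top. y \<in> T" and p: "p \<in> tail_limits S"
  obtains q where "q \<in> tail_limits T" "linked F (units_on S) (units_on T) p q"
proof -
  let ?U = "units_on S" and ?V = "units_on T"
  define A where "A g = {p f - \<epsilon> |f \<epsilon>. f \<in> ?U \<and> (\<forall>\<^sub>F z in F. \<bar>f (fst z) - g (snd z)\<bar> \<le> \<epsilon>)}" for g
  define q where "q = (\<lambda>g\<in>?V. Sup (A g))"
  have le: "p f - \<epsilon> \<le> p f' + \<epsilon>'"
    if "f \<in> ?U" "f' \<in> ?U" "\<forall>\<^sub>F z in F. \<bar>f (fst z) - g (snd z)\<bar> \<le> \<epsilon>"
       "\<forall>\<^sub>F z in F. \<bar>f' (fst z) - g (snd z)\<bar> \<le> \<epsilon>'" for f f' g \<epsilon> \<epsilon>'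
  proof -
    have "\<forall>\<^sub>F z in F. \<bar>f (fst z) - f' (fst z)\<bar> \<le> \<epsilon> + \<epsilon>'"
      using that(3,4) by eventually_elim linarith
    then have "\<forall>\<^sub>F x in filtermap fst F. \<bar>f x - f' x\<bar> \<le> \<epsilon> + \<epsilon>'"
      by (simp add: eventually_filtermap)
    then have "\<bar>p f - p f'\<bar> \<le> \<epsilon> + \<epsilon>'"
      using tail_limits_le[OF p that(1,2)] fst by simp
    then show ?thesis by linarith
  qed
  have near: "\<bar>p f - q g\<bar> \<le> \<epsilon>"
    if f: "f \<in> ?U" "g \<in> ?V" "\<forall>\<^sub>F z in F. \<bar>f (fst z) - g (snd z)\<bar> \<le> \<epsilon>" for f g \<epsilon>
  proof -
    have mem: "p f - \<epsilon> \<in> A g" using f by (auto simp: A_def)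
    have ub: "t \<le> p f + \<epsilon>" if "t \<in> A g" for t
      using that le f by (auto simp: A_def)
    have "p f - \<epsilon> \<le> Sup (A g)"
      using mem ub by (intro cSup_upper) (auto simp: bdd_above_def)
    moreover have "Sup (A g) \<le> p f + \<epsilon>"
      using mem ub by (intro cSup_least) auto
    ultimately show ?thesis using f(2) by (simp add: q_def abs_le_iff)
  qed
  have "q \<in> tail_limits T"
    unfolding tail_limits_def
  proof (intro CollectI conjI allI impI)
    have freq: "\<exists>\<^sub>F y in at_top. \<forall>g\<in>Gs. \<bar>q g - g y\<bar> < \<epsilon>"
      if G: "finite Gs" "Gs \<subseteq> ?V" "0 < \<epsilon>" for Gs \<epsilon>
    proof -
      \<comment> \<open>Three errors are added: from \<open>q g\<close> to \<open>p (h g)\<close>,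
        from there to the value of \<open>h g\<close>, and from that value to the value of
        \<open>g\<close>. Quarters keep the sum strictly below \<epsilon>.\<close>
      have "0 < \<epsilon> / 4" using G(3) by simp
      then have "\<forall>g\<in>Gs. \<exists>f. f \<in> ?U \<and> (\<forall>\<^sub>F z in F. \<bar>f (fst z) - g (snd z)\<bar> \<le> \<epsilon> / 4)"
        using approx G(2) unfolding approximates_def by blast
      from bchoice[OF this] obtain h where h: "\<And>g. g \<in> Gs \<Longrightarrow> h g \<in> ?U"
          "\<And>g. g \<in> Gs \<Longrightarrow> \<forall>\<^sub>F z in F. \<bar>h g (fst z) - g (snd z)\<bar> \<le> \<epsilon> / 4"
        by blast
      have "\<exists>\<^sub>F x in at_top. \<forall>f\<in>h ` Gs. \<bar>p f - f x\<bar> < \<epsilon> / 4"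
        using h(1) G by (intro tail_limitsD[OF p]) auto
      then have "\<exists>\<^sub>F z in F. \<forall>f\<in>h ` Gs. \<bar>p f - f (fst z)\<bar> < \<epsilon> / 4"
        by (simp add: fst[symmetric] frequently_def eventually_filtermap)
      moreover have "\<forall>\<^sub>F z in F. \<forall>g\<in>Gs. \<bar>h g (fst z) - g (snd z)\<bar> \<le> \<epsilon> / 4"
        using h(2) G(1) by (intro eventually_ball_finite) auto
      ultimately have "\<exists>\<^sub>F z in F. (\<forall>f\<in>h ` Gs. \<bar>p f - f (fst z)\<bar> < \<epsilon> / 4) \<and>
          (\<forall>g\<in>Gs. \<bar>h g (fst z) - g (snd z)\<bar> \<le> \<epsilon> / 4)"
        by (rule frequently_eventually_frequently)
      then have "\<exists>\<^sub>F z in F. \<forall>g\<in>Gs. \<bar>q g - g (snd z)\<bar> < \<epsilon>"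
      proof (rule frequently_elim1, intro ballI)
        fix z g assume z: "(\<forall>f\<in>h ` Gs. \<bar>p f - f (fst z)\<bar> < \<epsilon> / 4) \<and>
          (\<forall>g\<in>Gs. \<bar>h g (fst z) - g (snd z)\<bar> \<le> \<epsilon> / 4)" and g: "g \<in> Gs"
        have "\<bar>p (h g) - q g\<bar> \<le> \<epsilon> / 4" using near h g G(2) by blast
        moreover have "\<bar>p (h g) - h g (fst z)\<bar> < \<epsilon> / 4" "\<bar>h g (fst z) - g (snd z)\<bar> \<le> \<epsilon> / 4"
          using z g by auto
        ultimately show "\<bar>q g - g (snd z)\<bar> < \<epsilon>" using G(3) by linarith
      qed
      then show ?thesis
        by (simp add: snd[symmetric] frequently_def eventually_filtermap)
    qed
    then show "\<exists>\<^sub>F y in at_top. \<forall>g\<in>Gs. \<bar>q g - g y\<bar> < \<epsilon>"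
      if "finite Gs" "Gs \<subseteq> ?V" "0 < \<epsilon>" for Gs \<epsilon>
      using that by blast
    have "q g \<in> {0..1}" if g: "g \<in> ?V" for g
    proof -
      have bound: "\<exists>y. \<bar>q g - g y\<bar> < e \<and> g y \<in> {0..1}" if "0 < e" for e
      proof -
        have "\<exists>\<^sub>F y in at_top. (\<forall>g\<in>{g}. \<bar>q g - g y\<bar> < e) \<and> y \<in> T"
          using freq[of "{g}" e] g that tailT by (intro frequently_eventually_frequently) auto
        then obtain y where "\<bar>q g - g y\<bar> < e" "y \<in> T"
          using frequently_ex by fastforce
        then show ?thesis using unit_functionsD[OF g, of y] by auto
      qed
      have "0 \<le> q g"
        using bound[of "- q g"] by (cases "0 \<le> q g") auto
      moreover have "q g \<le> 1"
        using bound[of "q g - 1"] by (cases "q g \<le> 1") auto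
      ultimately show ?thesis by simp
    qed
    then show "q \<in> topspace (tychonoff_cube (top_of_set T))"
      by (simp add: topspace_tychonoff_cube q_def)
  qed
  moreover have "linked F ?U ?V p q"
    using near by (auto simp: linked_def)
  ultimately show ?thesis by (rule that)
qed

text \<open>On \<open>units_on T\<close> both values lie within \<open>e / 2\<close> of the same
  \<open>p f\<close>; elsewhere both are the default value of extensional functions.\<close>

lemma linked_unique:
  fixes T :: "'b::linorder_topology set"
  assumes approx: "approximates F U (units_on T)"
    and q: "q \<in> tail_limits T" "linked F U (units_on T) p q"
    and r: "r \<in> tail_limits T" "linked F U (units_on T) p r"
  shows "q = r"
proof
  fix g
  show "q g = r g"
  proof (cases "g \<in> units_on T")
    case True
    have "\<bar>q g - r g\<bar> \<le> 0 + e" if e: "0 < e" for e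
    proof -
      obtain f where f: "f \<in> U" "\<forall>\<^sub>F z in F. \<bar>f (fst z) - g (snd z)\<bar> \<le> e / 2"
        by (rule approximatesD[OF approx True half_gt_zero[OF e]])
      have "\<bar>p f - q g\<bar> \<le> e / 2" "\<bar>p f - r g\<bar> \<le> e / 2"
        by (rule linkedD[OF q(2) f(1) True f(2)], rule linkedD[OF r(2) f(1) True f(2)])
      then show ?thesis by linarith
    qed
    then have "\<bar>q g - r g\<bar> \<le> 0" by (rule field_le_epsilon)
    then show ?thesis by simp
  next
    case False
    then show ?thesis
      using q(1) r(1) by (auto simp: tail_limits_def topspace_tychonoff_cube PiE_def extensional_def)
  qed
qed

text \<open>Along the linked map, the coordinate at \<open>g\<close> differs from the coordinate at
  an approximant \<open>f\<close> by at most a prescribed error, uniformly in \<open>p\<close>. It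
  is thus a uniform limit of continuous functions.\<close>

lemma continuous_map_linked:
  fixes S :: "'a::linorder_topology set" and T :: "'b::linorder_topology set"
  assumes approx: "approximates F (units_on S) (units_on T)"
    and h: "\<And>p. p \<in> tail_limits S \<Longrightarrow> h p \<in> tail_limits T"
      "\<And>p. p \<in> tail_limits S \<Longrightarrow> linked F (units_on S) (units_on T) p (h p)"
  shows "continuous_map (subtopology (tychonoff_cube (top_of_set S)) (tail_limits S))
           (subtopology (tychonoff_cube (top_of_set T)) (tail_limits T)) h"
proof -
  let ?S = "subtopology (tychonoff_cube (top_of_set S)) (tail_limits S)"
  have top: "topspace ?S = tail_limits S"
    by (auto simp: tail_limits_def)
  have cont: "continuous_map ?S euclidean (\<lambda>p. h p g)" if g: "g \<in> units_on T" for g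
    unfolding continuous_map_def top
  proof (intro conjI allI impI)
    fix W :: "real set" assume "openin euclidean W"
    then have "open W" by simp
    show "openin ?S {p \<in> tail_limits S. h p g \<in> W}"
    proof (subst openin_subopen, intro ballI)
      fix p assume p: "p \<in> {p \<in> tail_limits S. h p g \<in> W}"
      then obtain e where e: "0 < e" "ball (h p g) e \<subseteq> W"
        using \<open>open W\<close> by (auto simp: open_contains_ball)
      have "0 < e / 4" using e(1) by simp
      then obtain f where f: "f \<in> units_on S" "\<forall>\<^sub>F z in F. \<bar>f (fst z) - g (snd z)\<bar> \<le> e / 4"
        by (rule approximatesD[OF approx g])
      let ?N = "{q \<in> topspace (tychonoff_cube (top_of_set S)). \<forall>f'\<in>{f}. \<bar>p f' - q f'\<bar> < e / 4} \<inter> tail_limits S"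
      have "openin ?S ?N"
        using f(1) by (intro openin_subtopology_Int cube_box_open) auto
      moreover have "p \<in> ?N" using p e(1) by (auto simp: tail_limits_def)
      moreover have "?N \<subseteq> {p \<in> tail_limits S. h p g \<in> W}"
      proof
        fix q assume q: "q \<in> ?N"
        then have "\<bar>q f - h q g\<bar> \<le> e / 4" "\<bar>p f - h p g\<bar> \<le> e / 4"
          using linkedD[OF h(2) f(1) g f(2)] p by blast+
        moreover have "\<bar>p f - q f\<bar> < e / 4" using q by simp
        ultimately have "\<bar>h p g - h q g\<bar> < e" using e(1) by linarith
        then show "q \<in> {p \<in> tail_limits S. h p g \<in> W}"
          using q e(2) by (auto simp: dist_real_def)
      qed
      ultimately show "\<exists>N. openin ?S N \<and> p \<in> N \<and> N \<subseteq> {p \<in> tail_limits S. h p g \<in> W}"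
        by blast
    qed
  qed auto
  have cube: "h p \<in> topspace (tychonoff_cube (top_of_set T))" if "p \<in> tail_limits S" for p
    using h(1)[OF that] by (simp add: tail_limits_def)
  have "continuous_map ?S (tychonoff_cube (top_of_set T)) h"
    unfolding tychonoff_cube_def[of "top_of_set T"] continuous_map_componentwise
  proof (intro conjI ballI)
    show "h ` topspace ?S \<subseteq> extensional (units_on T)"
      using cube unfolding top topspace_tychonoff_cube PiE_def by blast
    fix g assume g: "g \<in> units_on T"
    have "h p g \<in> {0..1}" if "p \<in> tail_limits S" for p
      using cube[OF that] g unfolding topspace_tychonoff_cube by blast
    then show "continuous_map ?S (top_of_set {0..1}) (\<lambda>p. h p g)"
      using cont[OF g] unfolding continuous_map_in_subtopology top by blast
  qed
  then show ?thesis
    using h(1) unfolding continuous_map_in_subtopology top by blast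
qed

text \<open>The linking relation is unchanged when the filter and the two sides are swapped, so
  existence, uniqueness and continuity apply in both directions and give mutually inverse
  maps.\<close>

theorem homeomorphic_tail_limits:
  fixes S :: "'a::linorder_topology set" and T :: "'b::linorder_topology set"
  assumes F: "filtermap fst F = at_top" "filtermap snd F = at_top"
    and approx: "approximates F (units_on S) (units_on T)"
      "approximates (filtermap prod.swap F) (units_on T) (units_on S)"
    and tail: "\<forall>\<^sub>F x in at_top. x \<in> S" "\<forall>\<^sub>F y in at_top. y \<in> T"
  shows "subtopology (tychonoff_cube (top_of_set S)) (tail_limits S)
    homeomorphic_space subtopology (tychonoff_cube (top_of_set T)) (tail_limits T)"
proof -
  let ?L = "linked F (units_on S) (units_on T)" and ?F' = "filtermap prod.swap F"
  have F': "filtermap fst ?F' = at_top" "filtermap snd ?F' = at_top"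
    using F by (simp_all add: filtermap_filtermap)
  have "\<forall>p. \<exists>q. p \<in> tail_limits S \<longrightarrow> q \<in> tail_limits T \<and> ?L p q"
    using linked_exists[OF F approx(1) tail(2)] by metis
  then obtain h where h: "\<And>p. p \<in> tail_limits S \<Longrightarrow> h p \<in> tail_limits T"
      "\<And>p. p \<in> tail_limits S \<Longrightarrow> ?L p (h p)"
    by metis
  have "\<forall>q. \<exists>p. q \<in> tail_limits T \<longrightarrow> p \<in> tail_limits S \<and> ?L p q"
    using linked_exists[OF F' approx(2) tail(1)] linked_swap by metis
  then obtain k where k: "\<And>q. q \<in> tail_limits T \<Longrightarrow> k q \<in> tail_limits S"
      "\<And>q. q \<in> tail_limits T \<Longrightarrow> ?L (k q) q"
    by metis
  have kh: "k (h p) = p" if "p \<in> tail_limits S" for p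
    using that by (intro linked_unique[OF approx(2), where p = "h p"]) (auto simp: linked_swap h k)
  have hk: "h (k q) = q" if "q \<in> tail_limits T" for q
    using that by (intro linked_unique[OF approx(1), where p = "k q"]) (auto simp: h k)
  have "homeomorphic_maps (subtopology (tychonoff_cube (top_of_set S)) (tail_limits S))
    (subtopology (tychonoff_cube (top_of_set T)) (tail_limits T)) h k"
    unfolding homeomorphic_maps_def
  proof (intro conjI ballI)
    show "continuous_map (subtopology (tychonoff_cube (top_of_set S)) (tail_limits S))
      (subtopology (tychonoff_cube (top_of_set T)) (tail_limits T)) h"
      by (rule continuous_map_linked[OF approx(1) h])
    show "continuous_map (subtopology (tychonoff_cube (top_of_set T)) (tail_limits T))
      (subtopology (tychonoff_cube (top_of_set S)) (tail_limits S)) k"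
      by (rule continuous_map_linked[OF approx(2)]) (simp_all add: k linked_swap)
  qed (auto simp: kh hk)
  then show ?thesis
    unfolding homeomorphic_space_def by blast
qed

section \<open>Rays and finite partial isomorphisms\<close>

text \<open>The ray is \<open>{a 0..}\<close> inside an order that may continue below
  \<open>a 0\<close>, as the half line does inside the reals. Connectedness and density are
  therefore asked only from \<open>a 0\<close> on.\<close>

locale ray =
  fixes a :: "nat \<Rightarrow> 'a::linorder_topology" and D :: "'a set"
  assumes connected_ray: "connected {a 0..}"
    and strict_mono_a: "strict_mono a"
    and cofinal: "\<exists>n. x \<le> a n"
    and a_in_D: "a n \<in> D"
    and D_dense: "a 0 \<le> x \<Longrightarrow> x < y \<Longrightarrow> \<exists>d\<in>D. x < d \<and> d < y"
begin

lemma a_le_iff [simp]: "a m \<le> a n \<longleftrightarrow> m \<le> n"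
  using strict_mono_a by (rule strict_mono_less_eq)

lemma a_less_iff [simp]: "a m < a n \<longleftrightarrow> m < n"
  using strict_mono_a by (rule strict_mono_less)

lemma unbounded: "\<exists>y. (x :: 'a) < y"
proof -
  obtain n where "x \<le> a n" using cofinal by blast
  then have "x < a (Suc n)" by (rule order.strict_trans1) simp
  then show ?thesis by blast
qed

lemma connected_seg: "a 0 \<le> u \<Longrightarrow> connected {u..v}"
  by (rule connected_Icc_of_connected[OF connected_ray]) auto

lemma seg_exists:
  assumes "a m \<le> x"
  obtains n where "m \<le> n" "x \<in> {a n..a (Suc n)}"
proof -
  have ex: "\<exists>k. x < a (Suc k)"
  proof -
    obtain n where "x \<le> a n" using cofinal by blast
    then have "x < a (Suc n)" by (rule order.strict_trans1) simp
    then show ?thesis by blast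
  qed
  define n where "n = (LEAST k. x < a (Suc k))"
  have n: "x < a (Suc n)" unfolding n_def using ex by (rule LeastI_ex)
  have "m < Suc n"
    using order.strict_trans1[OF assms n] by simp
  have "a n \<le> x"
  proof (cases "m = n")
    case False
    then obtain k where k: "n = Suc k" using \<open>m < Suc n\<close> by (cases n) auto
    then have "\<not> x < a (Suc k)"
      using not_less_Least[of k "\<lambda>k. x < a (Suc k)"] by (simp add: n_def)
    then show ?thesis by (simp add: k)
  qed (use assms in simp)
  then show ?thesis
    using that[of n] n \<open>m < Suc n\<close> by auto
qed

text \<open>The pasting lemma for two closed sets handles each initial interval by induction.
  Continuity on the ray is local, and every point has a neighbourhood \<open>{..<a (Suc m)}\<close>
  that sees only finitely many pieces.\<close>

lemma continuous_on_ray_glue: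
  fixes g :: "nat \<Rightarrow> 'a \<Rightarrow> 'b::topological_space"
  assumes cont: "\<And>n. continuous_on {a n..a (Suc n)} (g n)"
    and eq: "\<And>n. g n (a (Suc n)) = g (Suc n) (a (Suc n))"
  obtains G where "continuous_on {a 0..} G" "\<And>n x. x \<in> {a n..a (Suc n)} \<Longrightarrow> G x = g n x"
proof
  define k where "k x = (LEAST n. x \<le> a (Suc n))" for x
  define G where "G x = g (k x) x" for x
  show G: "G x = g n x" if x: "x \<in> {a n..a (Suc n)}" for n x
  proof -
    have "k x \<le> n" unfolding k_def using x by (intro Least_le) auto
    have kx: "x \<le> a (Suc (k x))" using LeastI[of "\<lambda>n. x \<le> a (Suc n)" n] x by (simp add: k_def)
    show ?thesis
    proof (cases "k x = n")
      case False
      have "a n \<le> a (Suc (k x))" using x kx by (meson atLeastAtMost_iff order_trans)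
      then have n: "n = Suc (k x)" using \<open>k x \<le> n\<close> False by simp
      then have "x = a (Suc (k x))" using x kx by (intro order.antisym) auto
      then show ?thesis using eq[of "k x"] n by (simp add: G_def)
    qed (simp add: G_def)
  qed
  have upto: "continuous_on {a 0..a m} G" for m
  proof (induction m)
    case (Suc m)
    have "continuous_on {a m..a (Suc m)} G"
      using cont[of m] by (rule continuous_on_eq) (simp add: G)
    moreover have "{a 0..a (Suc m)} = {a 0..a m} \<union> {a m..a (Suc m)}"
      by (simp add: ivl_disj_un_two_touch)
    ultimately show ?case
      using Suc.IH by (simp add: continuous_on_closed_Un)
  qed simp
  show "continuous_on {a 0..} G"
    unfolding continuous_on_eq_continuous_within
  proof
    fix x assume x: "x \<in> {a 0..}"
    obtain m where m: "x \<le> a m" using cofinal by blast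
    then have lt: "x < a (Suc m)" by (rule order.strict_trans1) simp
    have "continuous (at x within {a 0..a (Suc m)}) G"
      using upto[of "Suc m"] x lt by (simp add: continuous_on_eq_continuous_within)
    moreover have "at x within {a 0..} = at x within {a 0..a (Suc m)}"
      using lt by (intro at_within_nhd[of x "{..<a (Suc m)}"]) auto
    ultimately show "continuous (at x within {a 0..}) G" by simp
  qed
qed

text \<open>Two partitions that meet at a point outside \<open>D\<close> are concatenated by adding two nearby points
  of \<open>D\<close> around it, so that no loss in the triangle inequality accumulates.\<close>

lemma finite_oscillation_partition:
  fixes f :: "'a \<Rightarrow> real"
  assumes f: "continuous_on {a 0..} f" and "0 < \<epsilon>" and "a 0 \<le> u" "u \<le> v"
  obtains X where "finite X" "X \<subseteq> D"
    "\<And>y z. \<lbrakk>u \<le> y; y \<le> z; z \<le> v; \<forall>e\<in>X. \<not> (y < e \<and> e < z)\<rbrakk> \<Longrightarrow> \<bar>f y - f z\<bar> \<le> \<epsilon>"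
proof -
  let ?P = "\<lambda>u v. \<exists>X. finite X \<and> X \<subseteq> D \<and>
    (\<forall>y z. u \<le> y \<longrightarrow> y \<le> z \<longrightarrow> z \<le> v \<longrightarrow> (\<forall>e\<in>X. \<not> (y < e \<and> e < z)) \<longrightarrow> \<bar>f y - f z\<bar> \<le> \<epsilon>)"
  have nhd: "\<exists>W. open W \<and> x \<in> W \<and> (\<forall>y\<in>W. \<forall>z\<in>W. {y..z} \<subseteq> W) \<and>
      (\<forall>y\<in>W. \<forall>z\<in>W. a 0 \<le> y \<longrightarrow> a 0 \<le> z \<longrightarrow> \<bar>f y - f z\<bar> \<le> \<epsilon>)" if x: "a 0 \<le> x" for x
  proof -
    have "open (ball (f x) (\<epsilon> / 2))" "f x \<in> ball (f x) (\<epsilon> / 2)" using \<open>0 < \<epsilon>\<close> by auto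
    then obtain A where A: "open A" "x \<in> A" "\<And>y. a 0 \<le> y \<Longrightarrow> y \<in> A \<Longrightarrow> f y \<in> ball (f x) (\<epsilon> / 2)"
      using f[unfolded continuous_on_topological] x by (metis atLeast_iff)
    obtain W where W: "open W" "x \<in> W" "W \<subseteq> A" "\<And>y z. y \<in> W \<Longrightarrow> z \<in> W \<Longrightarrow> {y..z} \<subseteq> W"
      using open_contains_convex_nhd[OF A(1,2)] by metis
    have fW: "\<bar>f y - f z\<bar> \<le> \<epsilon>" if "y \<in> W" "z \<in> W" "a 0 \<le> y" "a 0 \<le> z" for y z
    proof -
      have "dist (f x) (f y) < \<epsilon> / 2" "dist (f x) (f z) < \<epsilon> / 2"
        using A(3) W(3) that by (auto simp: subset_eq)
      then show ?thesis unfolding dist_real_def by linarith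
    qed
    show ?thesis
      by (intro exI[of _ W] conjI ballI impI W(1,2,4) fW)
  qed
  have "?P u v"
  proof (rule connected_Icc_induct[where P = ?P, OF connected_seg[OF \<open>a 0 \<le> u\<close>] \<open>u \<le> v\<close>])
    fix x y x' y' assume "?P x y" and le: "x \<le> x'" "y' \<le> y"
    then obtain X where X: "finite X" "X \<subseteq> D" "\<And>s t. \<lbrakk>x \<le> s; s \<le> t; t \<le> y; \<forall>e\<in>X. \<not> (s < e \<and> e < t)\<rbrakk> \<Longrightarrow> \<bar>f s - f t\<bar> \<le> \<epsilon>"
      by (elim exE conjE) simp
    show "?P x' y'"
      using X(1,2) le by (intro exI[of _ X] conjI allI impI X(3)) auto
  next
    fix x y z assume xyz: "?P x y" "?P y z" "u \<le> x" "x \<le> y" "y \<le> z"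
    show "?P x z"
    \<comment> \<open>If one half is a single point there is nothing to glue. Otherwise the order
      has points on both sides of \<open>y\<close>, from which the one-sided neighbourhoods are
      obtained.\<close>
    proof (cases "x < y \<and> y < z")
      case False
      then have "x = y \<or> y = z" using xyz by auto
      then show ?thesis using xyz(1,2) by (elim disjE) simp_all
    next
      case True
      have "a 0 \<le> x" using xyz(3) \<open>a 0 \<le> u\<close> by (rule order_trans[rotated])
      then have "a 0 \<le> y" using xyz(4) by (rule order_trans)
      from nhd[OF this] obtain W where W: "open W" "y \<in> W" "\<And>s t. s \<in> W \<Longrightarrow> t \<in> W \<Longrightarrow> {s..t} \<subseteq> W"
          "\<And>s t. \<lbrakk>s \<in> W; t \<in> W; a 0 \<le> s; a 0 \<le> t\<rbrakk> \<Longrightarrow> \<bar>f s - f t\<bar> \<le> \<epsilon>"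
        by (elim exE conjE) simp
      obtain l where l: "l < y" "{l<..y} \<subseteq> W" using open_left[OF W(1,2)] True by blast
      obtain r where r: "y < r" "{y..<r} \<subseteq> W" using open_right[OF W(1,2)] True by blast
      obtain d where d: "d \<in> D" "max l x < d" "d < y"
        using D_dense[of "max l x" y] l True \<open>a 0 \<le> x\<close> by (auto simp: le_max_iff_disj)
      obtain e where e: "e \<in> D" "y < e" "e < r"
        using D_dense[of y r] r \<open>a 0 \<le> y\<close> by auto
      have "d \<in> W" "e \<in> W" using d e l r by auto
      then have deW: "{d..e} \<subseteq> W" by (rule W(3))
      have "a 0 \<le> d" using \<open>a 0 \<le> x\<close> d(2) by auto
      from xyz(1) obtain X where X: "finite X" "X \<subseteq> D" "\<And>s t. \<lbrakk>x \<le> s; s \<le> t; t \<le> y; \<forall>e\<in>X. \<not> (s < e \<and> e < t)\<rbrakk> \<Longrightarrow> \<bar>f s - f t\<bar> \<le> \<epsilon>"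
        by (elim exE conjE) simp
      from xyz(2) obtain Y where Y: "finite Y" "Y \<subseteq> D" "\<And>s t. \<lbrakk>y \<le> s; s \<le> t; t \<le> z; \<forall>e\<in>Y. \<not> (s < e \<and> e < t)\<rbrakk> \<Longrightarrow> \<bar>f s - f t\<bar> \<le> \<epsilon>"
        by (elim exE conjE) simp
      show ?thesis
      proof (intro exI[of _ "X \<union> Y \<union> {d, e}"] conjI allI impI)
        fix s t assume st: "x \<le> s" "s \<le> t" "t \<le> z" "\<forall>c\<in>X \<union> Y \<union> {d, e}. \<not> (s < c \<and> c < t)"
        consider "t \<le> y" | "y \<le> s" | "s < y" "y < t" by force
        then show "\<bar>f s - f t\<bar> \<le> \<epsilon>"
        proof cases
          case 1 then show ?thesis using st by (intro X(3)) auto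
        next
          case 2 then show ?thesis using st by (intro Y(3)) auto
        next
          case 3
          \<comment> \<open>A pair straddling \<open>y\<close> has neither \<open>d\<close> nor
            \<open>e\<close> strictly inside, so it is confined to \<open>{d..e}\<close>, where the
            oscillation is at most \<epsilon> directly.\<close>
          have "\<not> s < d" "\<not> e < t"
            using st(4) 3 d(3) e(2) by auto
          then have "s \<in> {d..e}" "t \<in> {d..e}" using 3 d(3) e(2) by auto
          moreover from this have "a 0 \<le> s" "a 0 \<le> t" using \<open>a 0 \<le> d\<close> by auto
          ultimately show ?thesis using deW by (intro W(4)) blast+
        qed
      qed (use X Y d e in auto)
    qed
  next
    fix x assume "u \<le> x"
    then have "a 0 \<le> x" using \<open>a 0 \<le> u\<close> by (rule order_trans[rotated])
    from nhd[OF this] obtain W where W: "open W" "x \<in> W" "\<And>s t. s \<in> W \<Longrightarrow> t \<in> W \<Longrightarrow> {s..t} \<subseteq> W"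
        "\<And>s t. \<lbrakk>s \<in> W; t \<in> W; a 0 \<le> s; a 0 \<le> t\<rbrakk> \<Longrightarrow> \<bar>f s - f t\<bar> \<le> \<epsilon>"
      by (elim exE conjE) simp
    show "\<exists>W. open W \<and> x \<in> W \<and>
      (\<forall>y z. y \<in> W \<longrightarrow> z \<in> W \<longrightarrow> u \<le> y \<longrightarrow> y \<le> z \<longrightarrow> z \<le> v \<longrightarrow> ?P y z)"
    proof (rule exI[of _ W], intro conjI allI impI W(1,2))
      fix y z assume yz: "y \<in> W" "z \<in> W" "u \<le> y"
      show "?P y z"
      proof (intro exI[of _ "{}"] conjI allI impI)
        fix s t assume st: "y \<le> s" "s \<le> t" "t \<le> z"
        then have "s \<in> W" "t \<in> W" using W(3)[OF yz(1,2)] by auto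
        moreover have "a 0 \<le> s" using \<open>a 0 \<le> u\<close> yz(3) st(1) by (meson order_trans)
        ultimately show "\<bar>f s - f t\<bar> \<le> \<epsilon>" using W(4) st(2) by (meson order_trans)
      qed auto
    qed
  qed
  then show ?thesis using that by (elim exE conjE) simp
qed

end

text \<open>In linear orders, the equivalence of the strict comparisons makes \<open>s\<close> the
  graph of an injective function, hence an order isomorphism. The end points are included so that
  functions interpolated on adjacent segments agree at the common cut point.\<close>

definition matching ::
  "(nat \<Rightarrow> 'a::linorder) \<Rightarrow> 'a set \<Rightarrow> (nat \<Rightarrow> 'b::linorder) \<Rightarrow> 'b set \<Rightarrow> nat \<Rightarrow> ('a \<times> 'b) set \<Rightarrow> bool" where
  "matching a D b E n s \<longleftrightarrow> finite s \<and>
     s \<subseteq> (D \<inter> {a n..a (Suc n)}) \<times> (E \<inter> {b n..b (Suc n)}) \<and>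
     (a n, b n) \<in> s \<and> (a (Suc n), b (Suc n)) \<in> s \<and>
     (\<forall>p\<in>s. \<forall>q\<in>s. fst p < fst q \<longleftrightarrow> snd p < snd q)"

lemma Ball_converse: "(\<forall>p\<in>s\<inverse>. P p) \<longleftrightarrow> (\<forall>p\<in>s. P (snd p, fst p))"
  by force

lemma matching_converse: "matching b E a D n (s\<inverse>) \<longleftrightarrow> matching a D b E n s"
proof -
  have sub: "s\<inverse> \<subseteq> B \<times> A \<longleftrightarrow> s \<subseteq> A \<times> B" for A :: "'b set" and B :: "'a set"
    by auto
  have "(\<forall>p\<in>s\<inverse>. \<forall>q\<in>s\<inverse>. fst p < fst q \<longleftrightarrow> snd p < snd q) \<longleftrightarrow>
      (\<forall>p\<in>s. \<forall>q\<in>s. fst p < fst q \<longleftrightarrow> snd p < snd q)"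
    unfolding Ball_converse by auto
  then show ?thesis
    unfolding matching_def by auto
qed

text \<open>The pair \<open>(x, y)\<close> could be added to \<open>s\<close> without spoiling the
  order isomorphism. It need not lie in \<open>D\<close> times \<open>E\<close>, so that arbitrary
  points of the two rays can be compared.\<close>

definition fits :: "('a::linorder \<times> 'b::linorder) set \<Rightarrow> 'a \<Rightarrow> 'b \<Rightarrow> bool" where
  "fits s x y \<longleftrightarrow> (\<forall>p\<in>s. (fst p < x \<longleftrightarrow> snd p < y) \<and> (x < fst p \<longleftrightarrow> y < snd p))"

lemma fits_converse: "fits (s\<inverse>) y x \<longleftrightarrow> fits s x y"
  unfolding fits_def Ball_converse by auto

lemma fits_mono: "fits t x y \<Longrightarrow> s \<subseteq> t \<Longrightarrow> fits s x y"
  unfolding fits_def by blast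

text \<open>The one-point step of back-and-forth. A point of the domain keeps its partner; any other
  point splits \<open>s\<close> into a lower and an upper part, and density of \<open>E\<close>
  supplies a point between their second coordinates. As \<open>x\<close> need not be in
  \<open>D\<close>, the same step later shows that the filter projects onto whole tails.\<close>

lemma fits_exists:
  assumes "ray b E" and m: "matching a D b E n s" and x: "x \<in> {a n..a (Suc n)}"
  obtains y where "y \<in> E \<inter> {b n..b (Suc n)}" "fits s x y"
proof -
  interpret ray b E by fact
  have s: "finite s" "(a n, b n) \<in> s" "(a (Suc n), b (Suc n)) \<in> s"
    "s \<subseteq> (D \<inter> {a n..a (Suc n)}) \<times> (E \<inter> {b n..b (Suc n)})"
    "\<And>p q. p \<in> s \<Longrightarrow> q \<in> s \<Longrightarrow> fst p < fst q \<longleftrightarrow> snd p < snd q"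
    using m unfolding matching_def by auto
  show ?thesis
  proof (cases "x \<in> Domain s")
    case True
    then obtain y where "(x, y) \<in> s" by blast
    then show ?thesis
      using s(4) s(5)[of _ "(x, y)"] s(5)[of "(x, y)"] that[of y] by (auto simp: fits_def)
  next
    case False
    then have ne: "fst p \<noteq> x" if "p \<in> s" for p
      using that by (cases p) auto
    define L where "L = snd ` {p\<in>s. fst p < x}"
    define R where "R = snd ` {p\<in>s. x < fst p}"
    have "a n < x" "x < a (Suc n)" using x ne[OF s(2)] ne[OF s(3)] by auto
    then have bL: "b n \<in> L" and bR: "b (Suc n) \<in> R"
      unfolding L_def R_def using s(2,3) by force+
    have fin: "finite L" "finite R" using s(1) by (auto simp: L_def R_def)
    have "Max L \<in> L" "Min R \<in> R" using fin bL bR by (auto intro!: Max_in Min_in)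
    then have "Max L < Min R"
      unfolding L_def R_def using s(5) by fastforce
    moreover have "b n \<le> Max L" "Min R \<le> b (Suc n)" using fin bL bR by auto
    moreover have "b 0 \<le> b n" by simp
    ultimately obtain y where y: "y \<in> E" "Max L < y" "y < Min R"
      using D_dense[of "Max L" "Min R"] by (meson order_trans)
    have "b n < y" "y < b (Suc n)"
      using \<open>b n \<le> Max L\<close> \<open>Min R \<le> b (Suc n)\<close> y by auto
    have "(fst p < x \<longleftrightarrow> snd p < y) \<and> (x < fst p \<longleftrightarrow> y < snd p)" if "p \<in> s" for p
    proof (cases "fst p < x")
      case True
      then have "snd p \<le> Max L" using fin(1) that by (auto simp: L_def)
      then show ?thesis using True y(2) by auto
    next
      case False
      then have "x < fst p" using ne[OF that] by auto
      then have "Min R \<le> snd p" using fin(2) that by (auto simp: R_def)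
      then show ?thesis using \<open>x < fst p\<close> y(3) by auto
    qed
    then have "fits s x y" by (simp add: fits_def)
    moreover have "y \<in> E \<inter> {b n..b (Suc n)}"
      using y(1) \<open>b n < y\<close> \<open>y < b (Suc n)\<close> by (simp add: less_imp_le)
    ultimately show ?thesis by (rule that[rotated])
  qed
qed

lemma matching_insert:
  assumes "matching a D b E n s" "x \<in> D \<inter> {a n..a (Suc n)}" "y \<in> E \<inter> {b n..b (Suc n)}" "fits s x y"
  shows "matching a D b E n (insert (x, y) s)"
  using assms unfolding matching_def fits_def by auto

lemma matching_extend_Domain:
  assumes "ray b E" "matching a D b E n s" "finite X" "X \<subseteq> D \<inter> {a n..a (Suc n)}"
  shows "\<exists>t. s \<subseteq> t \<and> matching a D b E n t \<and> X \<subseteq> Domain t"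
  using assms(3,4)
proof (induction X rule: finite_induct)
  case empty
  then show ?case using assms(2) by blast
next
  case (insert x X)
  then obtain t where t: "s \<subseteq> t" "matching a D b E n t" "X \<subseteq> Domain t" by blast
  obtain y where y: "y \<in> E \<inter> {b n..b (Suc n)}" "fits t x y"
    using fits_exists[OF assms(1) t(2)] insert.prems by blast
  then have "matching a D b E n (insert (x, y) t)"
    using matching_insert[OF t(2)] insert.prems by blast
  then show ?case using t by (intro exI[of _ "insert (x, y) t"]) auto
qed

lemma matching_extend_Range:
  assumes "ray a D" "matching a D b E n s" "finite Y" "Y \<subseteq> E \<inter> {b n..b (Suc n)}"
  shows "\<exists>t. s \<subseteq> t \<and> matching a D b E n t \<and> Y \<subseteq> Range t"
proof -
  have "matching b E a D n (s\<inverse>)" using assms(2) by (simp add: matching_converse)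
  from matching_extend_Domain[OF assms(1) this assms(3,4)]
  obtain t where "s\<inverse> \<subseteq> t" "matching b E a D n t" "Y \<subseteq> Domain t" by blast
  then show ?thesis
    using matching_converse[of a D b E n t] by (intro exI[of _ "t\<inverse>"]) auto
qed

lemma matching_base:
  assumes "ray a D" "ray b E"
  shows "matching a D b E n {(a n, b n), (a (Suc n), b (Suc n))}"
proof -
  interpret A: ray a D by fact
  interpret B: ray b E by fact
  show ?thesis
    unfolding matching_def by (auto simp: A.a_in_D B.a_in_D)
qed

section \<open>A chain of length continuum\<close>

text \<open>A diagonal argument. Some member \<open>m k\<close> eventually bounds the first
  \<open>k + 1\<close> members; at coordinate \<open>n\<close> the bound uses the largest
  \<open>k\<close> for which this already holds at \<open>n\<close>. As each coordinate of
  \<open>g\<close> is copied from a member of the chain, \<open>g\<close> keeps every coordinatewise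
  property of the members.\<close>

lemma countable_chain_upper_bound:
  fixes c :: "nat \<Rightarrow> nat \<Rightarrow> 'c set"
  assumes chain: "\<And>i j. (\<forall>\<^sub>F n in sequentially. c i n \<subseteq> c j n) \<or> (\<forall>\<^sub>F n in sequentially. c j n \<subseteq> c i n)"
  obtains g where "\<And>n. \<exists>i. g n = c i n" "\<And>i. \<forall>\<^sub>F n in sequentially. c i n \<subseteq> g n"
proof -
  have "\<exists>m. \<forall>i\<le>k. \<forall>\<^sub>F n in sequentially. c i n \<subseteq> c m n" for k
  proof (induction k)
    case (Suc k)
    then obtain m where m: "\<And>i. i \<le> k \<Longrightarrow> \<forall>\<^sub>F n in sequentially. c i n \<subseteq> c m n" by blast
    from chain[of m "Suc k"] show ?case
    proof
      assume *: "\<forall>\<^sub>F n in sequentially. c m n \<subseteq> c (Suc k) n"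
      have "\<forall>\<^sub>F n in sequentially. c i n \<subseteq> c (Suc k) n" if "i \<le> Suc k" for i
      proof (cases "i = Suc k")
        case False
        then have "\<forall>\<^sub>F n in sequentially. c i n \<subseteq> c m n" using that by (intro m) simp
        then show ?thesis using * by eventually_elim (rule subset_trans)
      qed simp
      then show ?thesis by blast
    next
      assume "\<forall>\<^sub>F n in sequentially. c (Suc k) n \<subseteq> c m n"
      then have "\<forall>\<^sub>F n in sequentially. c i n \<subseteq> c m n" if "i \<le> Suc k" for i
        using m[of i] that by (cases "i = Suc k") auto
      then show ?thesis by blast
    qed
  qed (auto intro: exI[of _ 0])
  then obtain m where m: "\<And>k i. i \<le> k \<Longrightarrow> \<forall>\<^sub>F n in sequentially. c i n \<subseteq> c (m k) n" by metis
  \<comment> \<open>The restriction \<open>k \<le> n\<close> makes the maximum exist, and each fixed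
    \<open>i\<close> belongs to \<open>K n\<close> for all large \<open>n\<close>.\<close>
  define K where "K n = {k. k \<le> n \<and> (\<forall>i\<le>k. c i n \<subseteq> c (m k) n)}" for n
  define g where "g n = (if K n = {} then c 0 n else c (m (Max (K n))) n)" for n
  have fin: "finite (K n)" for n unfolding K_def by (rule finite_subset[of _ "{..n}"]) auto
  show ?thesis
  proof
    show "\<exists>i. g n = c i n" for n by (auto simp: g_def)
    show "\<forall>\<^sub>F n in sequentially. c i n \<subseteq> g n" for i
    proof -
      have "\<forall>\<^sub>F n in sequentially. \<forall>j\<in>{..i}. c j n \<subseteq> c (m i) n"
        using m by (intro eventually_ball_finite) auto
      then show ?thesis
        using eventually_ge_at_top[of i]
      proof eventually_elim
        case (elim n)
        then have i: "i \<in> K n" by (simp add: K_def)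
        then have "Max (K n) \<in> K n" "i \<le> Max (K n)" using fin by (auto intro: Max_in)
        then have "c i n \<subseteq> c (m (Max (K n))) n" unfolding K_def by blast
        then show "c i n \<subseteq> g n" using i by (auto simp: g_def)
      qed
    qed
  qed
qed

lemma countable_underS_of_CH:
  assumes "Continuum_Hypothesis"
  shows "countable (underS |UNIV :: nat set set| x)"
proof -
  let ?r = "|UNIV :: nat set set|"
  have "|underS ?r x| <o ?r"
    by (rule card_of_underS[OF card_of_Card_order]) (simp add: Field_card_of)
  also have "?r =o cardSuc natLeq"
    using assms by (simp add: Continuum_Hypothesis_def continuum_def)
  finally have "|underS ?r x| <o cardSuc natLeq" .
  then have "|underS ?r x| \<le>o natLeq"
    using cardSuc_ordLeq_ordLess[OF natLeq_Card_order card_of_Card_order] by blast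
  then show ?thesis by (simp add: countable_card_le_natLeq)
qed

text \<open>Each set of naturals \<open>A\<close> is a stage with task \<open>Q A\<close>. The
  earlier values form a countable chain modulo finite; its diagonal bound still satisfies
  \<open>M\<close> in each coordinate and is then enlarged coordinate by coordinate to meet the
  task.\<close>

lemma CH_chain_exists:
  fixes M :: "nat \<Rightarrow> 'c set \<Rightarrow> bool" and Q :: "nat set \<Rightarrow> nat \<Rightarrow> 'c set \<Rightarrow> bool"
  assumes CH: "Continuum_Hypothesis"
    and base: "\<And>n. \<exists>s. M n s"
    and ext: "\<And>A n s. M n s \<Longrightarrow> \<exists>t. s \<subseteq> t \<and> M n t \<and> Q A n t"
  obtains H where "\<And>A n. M n (H A n)" "\<And>A n. Q A n (H A n)"
    "\<And>A B. (\<forall>\<^sub>F n in sequentially. H A n \<subseteq> H B n) \<or> (\<forall>\<^sub>F n in sequentially. H B n \<subseteq> H A n)"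
proof -
  let ?r = "|UNIV :: nat set set|"
  let ?R = "?r - Id"
  let ?le = "\<lambda>g h. \<forall>\<^sub>F n in sequentially. g n \<subseteq> (h n :: 'c set)"
  \<comment> \<open>\<open>P f x h\<close> says that \<open>h\<close> is a legitimate value at stage
    \<open>x\<close> when \<open>f\<close> holds the earlier values; it looks at \<open>f\<close>
    only below \<open>x\<close>, as well-founded choice requires.\<close>
  define P where "P f x h \<longleftrightarrow> (\<forall>n. M n (h n) \<and> Q x n (h n)) \<and> (\<forall>z. (z, x) \<in> ?R \<longrightarrow> ?le (f z) h)"
    for f :: "nat set \<Rightarrow> nat \<Rightarrow> 'c set" and x h
  have wo: "well_order_on UNIV ?r"
    using card_of_well_order_on[of "UNIV :: nat set set"] .
  then have wf: "wf ?R" by (simp add: well_order_on_def)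
  have total: "(x, y) \<in> ?R \<or> (y, x) \<in> ?R" if "x \<noteq> y" for x y
    using wo that by (auto simp: well_order_on_def linear_order_on_def total_on_def)
  have R_underS: "(z, x) \<in> ?R \<longleftrightarrow> z \<in> underS ?r x" for z x
    by (auto simp: underS_def)
  have "\<exists>f. \<forall>x. P f x (f x)"
  proof (rule dependent_wf_choice[OF wf])
    show "P f x h = P g x h" if "\<And>z. (z, x) \<in> ?R \<Longrightarrow> f z = g z" for f g x h
      using that by (auto simp: P_def)
    fix x f assume IH: "\<And>y. (y, x) \<in> ?R \<Longrightarrow> P f y (f y)"
    have "\<exists>g. (\<forall>n. M n (g n)) \<and> (\<forall>z. (z, x) \<in> ?R \<longrightarrow> ?le (f z) g)"
    proof (cases "underS ?r x = {}")
      case True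
      obtain g where "\<And>n. M n (g n)" using base by metis
      then show ?thesis using True R_underS by blast
    next
      case False
      define e where "e = from_nat_into (underS ?r x)"
      have range: "range e = underS ?r x"
        unfolding e_def by (rule range_from_nat_into[OF False countable_underS_of_CH[OF CH]])
      have eR: "(e i, x) \<in> ?R" for i using range R_underS by blast
      have "?le (f (e i)) (f (e j)) \<or> ?le (f (e j)) (f (e i))" for i j
      proof (cases "e i = e j")
        case False
        from total[OF this] show ?thesis
          using IH[OF eR[of i]] IH[OF eR[of j]] unfolding P_def by blast
      qed simp
      then obtain g where g: "\<And>n. \<exists>i. g n = f (e i) n" "\<And>i. ?le (f (e i)) g"
        using countable_chain_upper_bound[of "\<lambda>i. f (e i)"] by metis
      have "M n (g n)" for n
      proof -
        obtain i where "g n = f (e i) n" using g(1) by blast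
        then show ?thesis using IH[OF eR[of i]] by (simp add: P_def)
      qed
      moreover have "?le (f z) g" if "(z, x) \<in> ?R" for z
      proof -
        have "z \<in> range e" unfolding range using that R_underS by simp
        then obtain i where "z = e i" by (rule rangeE)
        then show ?thesis using g(2) by simp
      qed
      ultimately show ?thesis by blast
    qed
    then obtain g where g: "\<And>n. M n (g n)" "\<And>z. (z, x) \<in> ?R \<Longrightarrow> ?le (f z) g" by blast
    have "\<forall>n. \<exists>t. g n \<subseteq> t \<and> M n t \<and> Q x n t" using ext g(1) by blast
    then obtain h where h: "\<And>n. g n \<subseteq> h n" "\<And>n. M n (h n)" "\<And>n. Q x n (h n)" by metis
    have "?le (f z) h" if "(z, x) \<in> ?R" for z
      using g(2)[OF that] by eventually_elim (use h(1) in blast)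
    then have "P f x h" using h(2,3) by (simp add: P_def)
    then show "\<exists>h. P f x h" by (rule exI[of _ h])
  qed
  then obtain H where H: "\<And>x. P H x (H x)" by blast
  show ?thesis
  proof
    show "M n (H A n)" "Q A n (H A n)" for A n using H by (auto simp: P_def)
    show "?le (H A) (H B) \<or> ?le (H B) (H A)" for A B
    proof (cases "A = B")
      case False
      from total[OF this] show ?thesis using H[of A] H[of B] unfolding P_def by blast
    qed simp
  qed
qed

text \<open>A set of naturals codes a sequence of finite sets of sets of naturals: the slice with index
  \<open>(n, 0)\<close> carries the length \<open>l\<close> of the \<open>n\<close>-th list, the slices \<open>(n, 1), \<dots>, (n, l)\<close> its entries.\<close>

definition slice :: "nat set \<Rightarrow> nat \<Rightarrow> nat \<Rightarrow> nat set" where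
  "slice A n i = {j. prod_encode (prod_encode (n, i), j) \<in> A}"

definition decode :: "nat set \<Rightarrow> nat \<Rightarrow> nat set set" where
  "decode A n = (\<lambda>i. slice A n (Suc i)) ` {..<card (slice A n 0)}"

text \<open>Every set of naturals is a code: the length is read off with \<open>card\<close>, which
  is 0 for an infinite slice. Hence all sets can serve as stages of the recursion.\<close>

lemma finite_decode: "finite (decode A n)"
  by (simp add: decode_def)

lemma decode_surj:
  assumes "\<And>n. finite (F n)"
  obtains A where "\<And>n. decode A n = F n"
proof -
  have "\<forall>n. \<exists>l s. F n = s ` {..<l :: nat}"
    using assms by (metis finite_imp_nat_seg_image_inj_on lessThan_def)
  then obtain l s where ls: "\<And>n. F n = s n ` {..<l n :: nat}" by metis
  define A where "A = {k. case prod_decode k of (ni, j) \<Rightarrow> case prod_decode ni of (n, i) \<Rightarrow>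
    (case i of 0 \<Rightarrow> j < l n | Suc i' \<Rightarrow> j \<in> s n i')}"
  have "slice A n 0 = {..<l n}" "slice A n (Suc i) = s n i" for n i
    by (auto simp: slice_def A_def)
  then have "decode A n = F n" for n
    by (simp add: decode_def ls)
  then show ?thesis by (rule that)
qed

section \<open>The filter of an interlacing\<close>

lemma abs_convex_combination_le:
  fixes t :: real
  assumes "0 \<le> t" "t \<le> 1" "\<bar>p - r\<bar> \<le> \<epsilon>" "\<bar>q - r\<bar> \<le> \<epsilon>"
  shows "\<bar>p + t * (q - p) - r\<bar> \<le> \<epsilon>"
proof -
  have "p + t * (q - p) - r = (1 - t) * (p - r) + t * (q - r)" by (simp add: algebra_simps)
  also have "\<bar>\<dots>\<bar> \<le> (1 - t) * \<bar>p - r\<bar> + t * \<bar>q - r\<bar>"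
    using abs_triangle_ineq[of "(1 - t) * (p - r)" "t * (q - r)"] assms(1,2)
    by (simp add: abs_mult)
  also have "\<dots> \<le> (1 - t) * \<epsilon> + t * \<epsilon>"
    using assms by (intro add_mono mult_left_mono) auto
  finally show ?thesis by (simp add: algebra_simps)
qed

text \<open>Induction on the number of pairs. An interior pair \<open>(d, e)\<close> splits the
  problem into two halves that share the value \<open>f e\<close> at \<open>d\<close>. Without
  interior pairs, \<open>f\<close> stays within \<epsilon> of both end values on all of
  \<open>{w..z}\<close>, and a Urysohn function interpolates between those values by convex
  combinations.\<close>

lemma interpolation:
  fixes s :: "('a::linorder_topology \<times> 'b::linorder) set" and f :: "'b \<Rightarrow> real"
  assumes "connected {u..v}" "u \<le> v" "finite s" "(u, w) \<in> s" "(v, z) \<in> s"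
    and "\<And>p. p \<in> s \<Longrightarrow> u \<le> fst p \<and> fst p \<le> v"
    and "\<And>p q. p \<in> s \<Longrightarrow> q \<in> s \<Longrightarrow> fst p < fst q \<longleftrightarrow> snd p < snd q"
    and "\<And>y y'. \<lbrakk>w \<le> y; y \<le> y'; y' \<le> z; \<forall>p\<in>s. \<not> (y < snd p \<and> snd p < y')\<rbrakk> \<Longrightarrow> \<bar>f y - f y'\<bar> \<le> \<epsilon>"
    and "\<And>y. w \<le> y \<Longrightarrow> y \<le> z \<Longrightarrow> f y \<in> {0..1}"
  shows "\<exists>g. continuous_on {u..v} g \<and> g u = f w \<and> g v = f z \<and> (\<forall>x\<in>{u..v}. g x \<in> {0..1}) \<and>
    (\<forall>x\<in>{u..v}. \<forall>y\<in>{w..z}. fits s x y \<longrightarrow> \<bar>g x - f y\<bar> \<le> \<epsilon>)"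
  using assms
proof (induction "card s" arbitrary: s u v w z rule: less_induct)
  case (less s u v w z)
  note conn = less.prems(1) and uv = less.prems(2) and fin = less.prems(3)
    and uw = less.prems(4) and vz = less.prems(5) and bnd = less.prems(6)
    and iso = less.prems(7) and osc = less.prems(8) and unit = less.prems(9)
  have iso': "x < x' \<longleftrightarrow> y < y'" if "(x, y) \<in> s" "(x', y') \<in> s" for x y x' y'
    using iso[OF that] by simp
  have wz: "w \<le> z" using iso'[OF vz uw] uv by (simp add: not_less[symmetric])
  show ?case
  proof (cases "\<exists>d e. (d, e) \<in> s \<and> u < d \<and> d < v")
    case True
    then obtain d e where de: "(d, e) \<in> s" "u < d" "d < v" by blast
    have we: "w < e" "e < z" using iso'[OF uw de(1)] iso'[OF de(1) vz] de by auto
    let ?s1 = "{p \<in> s. fst p \<le> d}" and ?s2 = "{p \<in> s. d \<le> fst p}"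
    have "(v, z) \<notin> ?s1" "(u, w) \<notin> ?s2" using de(2,3) by auto
    then have sub1: "?s1 \<subset> s" and sub2: "?s2 \<subset> s" using vz uw by blast+
    have "{u..d} \<subseteq> {u..v}" "{d..v} \<subseteq> {u..v}" using de by auto
    note conns = this[THEN connected_Icc_of_connected[OF conn]]
    have "\<exists>g. continuous_on {u..d} g \<and> g u = f w \<and> g d = f e \<and> (\<forall>x\<in>{u..d}. g x \<in> {0..1}) \<and>
      (\<forall>x\<in>{u..d}. \<forall>y\<in>{w..e}. fits ?s1 x y \<longrightarrow> \<bar>g x - f y\<bar> \<le> \<epsilon>)"
    proof (rule less.hyps)
      show "card ?s1 < card s" by (rule psubset_card_mono[OF fin sub1])
      fix y y' assume y: "w \<le> y" "y \<le> y'" "y' \<le> e" and no: "\<forall>p\<in>?s1. \<not> (y < snd p \<and> snd p < y')"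
      show "\<bar>f y - f y'\<bar> \<le> \<epsilon>"
      proof (rule osc)
        \<comment> \<open>A pair whose second coordinate lies below \<open>y' \<le> e\<close> has
          its first coordinate below \<open>d\<close>, so the left half of \<open>s\<close> already
          contains it.\<close>
        show "\<forall>p\<in>s. \<not> (y < snd p \<and> snd p < y')"
        proof (intro ballI notI)
          fix p assume p: "p \<in> s" "y < snd p \<and> snd p < y'"
          then have "fst p < d" using iso[OF p(1) de(1)] y(3) by auto
          then have "p \<in> ?s1" using p(1) by (simp add: less_imp_le)
          then show False using no p(2) by blast
        qed
      qed (use y we in auto)
    qed (use conns de we fin uw bnd iso unit in auto)
    then obtain g1 where g1: "continuous_on {u..d} g1" "g1 u = f w" "g1 d = f e"
        "\<And>x. x \<in> {u..d} \<Longrightarrow> g1 x \<in> {0..1}"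
        "\<And>x y. \<lbrakk>x \<in> {u..d}; y \<in> {w..e}; fits ?s1 x y\<rbrakk> \<Longrightarrow> \<bar>g1 x - f y\<bar> \<le> \<epsilon>" by blast
    have "\<exists>g. continuous_on {d..v} g \<and> g d = f e \<and> g v = f z \<and> (\<forall>x\<in>{d..v}. g x \<in> {0..1}) \<and>
      (\<forall>x\<in>{d..v}. \<forall>y\<in>{e..z}. fits ?s2 x y \<longrightarrow> \<bar>g x - f y\<bar> \<le> \<epsilon>)"
    proof (rule less.hyps)
      show "card ?s2 < card s" by (rule psubset_card_mono[OF fin sub2])
      fix y y' assume y: "e \<le> y" "y \<le> y'" "y' \<le> z" and no: "\<forall>p\<in>?s2. \<not> (y < snd p \<and> snd p < y')"
      show "\<bar>f y - f y'\<bar> \<le> \<epsilon>"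
      proof (rule osc)
        show "\<forall>p\<in>s. \<not> (y < snd p \<and> snd p < y')"
        proof (intro ballI notI)
          fix p assume p: "p \<in> s" "y < snd p \<and> snd p < y'"
          then have "d < fst p" using iso[OF de(1) p(1)] y(1) by auto
          then have "p \<in> ?s2" using p(1) by (simp add: less_imp_le)
          then show False using no p(2) by blast
        qed
      qed (use y we in auto)
    qed (use conns de we fin vz bnd iso unit in auto)
    then obtain g2 where g2: "continuous_on {d..v} g2" "g2 d = f e" "g2 v = f z"
        "\<And>x. x \<in> {d..v} \<Longrightarrow> g2 x \<in> {0..1}"
        "\<And>x y. \<lbrakk>x \<in> {d..v}; y \<in> {e..z}; fits ?s2 x y\<rbrakk> \<Longrightarrow> \<bar>g2 x - f y\<bar> \<le> \<epsilon>" by blast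
    let ?g = "\<lambda>x. if x \<le> d then g1 x else g2 x"
    have "continuous_on ({u..d} \<union> {d..v}) ?g"
    proof (rule continuous_on_cases)
      show "\<forall>x. x \<in> {u..d} \<and> \<not> x \<le> d \<or> x \<in> {d..v} \<and> x \<le> d \<longrightarrow> g1 x = g2 x"
      proof (intro allI impI)
        fix x assume "x \<in> {u..d} \<and> \<not> x \<le> d \<or> x \<in> {d..v} \<and> x \<le> d"
        then have "x = d" by auto
        then show "g1 x = g2 x" by (simp add: g1(3) g2(2))
      qed
    qed (use g1(1) g2(1) in auto)
    moreover have "{u..d} \<union> {d..v} = {u..v}" using de by (intro ivl_disj_un_two_touch) auto
    moreover have "\<bar>?g x - f y\<bar> \<le> \<epsilon>" if xy: "x \<in> {u..v}" "y \<in> {w..z}" "fits s x y" for x y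
    proof -
      have side: "(d < x \<longleftrightarrow> e < y) \<and> (x < d \<longleftrightarrow> y < e)"
        using xy(3) de(1) unfolding fits_def by force
      have fit: "fits ?s1 x y" "fits ?s2 x y" using xy(3) by (auto intro: fits_mono)
      show ?thesis
      proof (cases "x \<le> d")
        case True
        then have "y \<le> e" using side by (simp add: not_less[symmetric])
        then show ?thesis using True xy fit(1) g1(5)[of x y] by auto
      next
        case False
        then have "e \<le> y" "d \<le> x" using side by (auto simp: not_le)
        then show ?thesis using False xy fit(2) g2(5)[of x y] by auto
      qed
    qed
    moreover have "?g x \<in> {0..1}" if "x \<in> {u..v}" for x
      using g1(4)[of x] g2(4)[of x] that by auto
    moreover have "?g u = f w" "?g v = f z" using g1(2) g2(3) de by auto
    ultimately show ?thesis
      by (intro exI[of _ ?g] conjI ballI impI) (simp_all only:)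
  next
    case False
    have near: "\<bar>f w - f y\<bar> \<le> \<epsilon>" "\<bar>f z - f y\<bar> \<le> \<epsilon>" if y: "w \<le> y" "y \<le> z" for y
    proof -
      have no: "\<not> (w < snd p \<and> snd p < z)" if "p \<in> s" for p
        using False iso[OF uw that] iso[OF that vz] that by (cases p) auto
      have no': "\<forall>p\<in>s. \<not> (w < snd p \<and> snd p < y)" "\<forall>p\<in>s. \<not> (y < snd p \<and> snd p < z)"
        using no y by (meson order.strict_trans1 order.strict_trans2)+
      show "\<bar>f w - f y\<bar> \<le> \<epsilon>"
        by (rule osc[OF _ y no'(1)]) simp
      have "\<bar>f y - f z\<bar> \<le> \<epsilon>"
        by (rule osc[OF y _ no'(2)]) simp
      then show "\<bar>f z - f y\<bar> \<le> \<epsilon>" by (simp add: abs_minus_commute)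
    qed
    show ?thesis
    proof (cases "u = v")
      case True
      then have "w = z" using iso'[OF uw vz] wz by auto
      then show ?thesis
        using True near unit[of w] by (intro exI[of _ "\<lambda>_. f w"] conjI ballI impI) auto
    next
      case False
      then have "u < v" using uv by simp
      then obtain t :: "'a \<Rightarrow> real" where t: "continuous_on UNIV t" "\<And>x. t x \<in> {0..1}"
          "\<And>x. x \<le> u \<Longrightarrow> t x = 0" "\<And>x. v \<le> x \<Longrightarrow> t x = 1"
        using connected_Icc_Urysohn[OF conn] by metis
      let ?g = "\<lambda>x. f w + t x * (f z - f w)"
      have "continuous_on {u..v} ?g"
        using continuous_on_subset[OF t(1)] by (intro continuous_intros) auto
      moreover have "?g x \<in> {0..1}" for x
      proof -
        have "0 \<le> f w" "f w \<le> 1" "0 \<le> f z" "f z \<le> 1"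
          using unit[of w] unit[of z] wz by auto
        \<comment> \<open>Membership in the unit interval is distance at most 1/2 from 1/2, so the
          convexity estimate applies to it as well.\<close>
        then have "\<bar>f w - 1 / 2\<bar> \<le> 1 / 2" "\<bar>f z - 1 / 2\<bar> \<le> 1 / 2"
          unfolding abs_le_iff by linarith+
        then have "\<bar>?g x - 1 / 2\<bar> \<le> 1 / 2"
          using t(2)[of x] by (intro abs_convex_combination_le) auto
        then show ?thesis unfolding abs_le_iff atLeastAtMost_iff by linarith
      qed
      moreover have "\<bar>?g x - f y\<bar> \<le> \<epsilon>" if "y \<in> {w..z}" for x y
        using t(2)[of x] near[of y] that by (intro abs_convex_combination_le) auto
      ultimately show ?thesis
        using t(3)[of u] t(4)[of v] by (intro exI[of _ ?g] conjI ballI impI) auto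
    qed
  qed
qed

text \<open>The outcome of the transfinite construction, stated symmetrically in the two rays, so
  that passing to converses exchanges their roles. A single index must cover a whole sequence of
  finite sets, in all segments at once.\<close>

locale interlacing = A: ray a D + B: ray b E
  for a :: "nat \<Rightarrow> 'a::linorder_topology" and D and b :: "nat \<Rightarrow> 'b::linorder_topology" and E +
  fixes H :: "'i \<Rightarrow> nat \<Rightarrow> ('a \<times> 'b) set"
  assumes matching: "matching a D b E n (H i n)"
    and chain: "(\<forall>\<^sub>F n in sequentially. H i n \<subseteq> H j n) \<or> (\<forall>\<^sub>F n in sequentially. H j n \<subseteq> H i n)"
    and covers_Domain: "(\<And>n. finite (X n)) \<Longrightarrow> (\<And>n. X n \<subseteq> D \<inter> {a n..a (Suc n)}) \<Longrightarrow>
      \<exists>i. \<forall>n. X n \<subseteq> Domain (H i n)"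
    and covers_Range: "(\<And>n. finite (Y n)) \<Longrightarrow> (\<And>n. Y n \<subseteq> E \<inter> {b n..b (Suc n)}) \<Longrightarrow>
      \<exists>i. \<forall>n. Y n \<subseteq> Range (H i n)"
begin

lemma interlacing_converse: "interlacing b E a D (\<lambda>i n. (H i n)\<inverse>)"
proof
  show "matching b E a D n ((H i n)\<inverse>)" for i n
    using matching by (simp add: matching_converse)
  show "(\<forall>\<^sub>F n in sequentially. (H i n)\<inverse> \<subseteq> (H j n)\<inverse>) \<or>
    (\<forall>\<^sub>F n in sequentially. (H j n)\<inverse> \<subseteq> (H i n)\<inverse>)" for i j
    using chain by simp
  show "\<exists>i. \<forall>n. X n \<subseteq> Domain ((H i n)\<inverse>)"
    if "\<And>n. finite (X n)" "\<And>n. X n \<subseteq> E \<inter> {b n..b (Suc n)}" for X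
    using covers_Range[of X] that by simp
  show "\<exists>i. \<forall>n. Y n \<subseteq> Range ((H i n)\<inverse>)"
    if "\<And>n. finite (Y n)" "\<And>n. Y n \<subseteq> D \<inter> {a n..a (Suc n)}" for Y
    using covers_Domain[of Y] that by simp
qed

definition fitting :: "'i \<Rightarrow> nat \<Rightarrow> ('a \<times> 'b) set" where
  "fitting i m = {(x, y). \<exists>n\<ge>m. x \<in> {a n..a (Suc n)} \<and> y \<in> {b n..b (Suc n)} \<and> fits (H i n) x y}"

definition fitting_filter :: "('a \<times> 'b) filter" where
  "fitting_filter = (INF (i, m). principal (fitting i m))"

text \<open>A larger condition is fitted by fewer pairs. Two conditions of the chain are comparable
  from some segment on, and raising the starting index past it removes the exceptions. Thus the sets
  \<open>fitting i m\<close> form a filter base.\<close>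

lemma fitting_directed:
  "\<exists>k l. fitting k l \<subseteq> fitting i m \<inter> fitting j m'"
proof -
  have *: "\<exists>k l. fitting k l \<subseteq> fitting i m \<inter> fitting j m'"
    if "\<forall>\<^sub>F n in sequentially. H i n \<subseteq> H j n" for i j m m'
  proof -
    obtain N where N: "\<And>n. n \<ge> N \<Longrightarrow> H i n \<subseteq> H j n"
      using \<open>\<forall>\<^sub>F n in sequentially. H i n \<subseteq> H j n\<close> by (auto simp: eventually_sequentially)
    have "fitting j (max N (max m m')) \<subseteq> fitting i m \<inter> fitting j m'"
    proof
      fix z assume "z \<in> fitting j (max N (max m m'))"
      then obtain x y n where z: "z = (x, y)" and n: "max N (max m m') \<le> n"
          and xy: "x \<in> {a n..a (Suc n)}" "y \<in> {b n..b (Suc n)}" "fits (H j n) x y"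
        unfolding fitting_def by blast
      from n have n': "N \<le> n" "m \<le> n" "m' \<le> n" by auto
      have "fits (H i n) x y" using xy(3) N[OF n'(1)] by (rule fits_mono)
      then show "z \<in> fitting i m \<inter> fitting j m'"
        unfolding z fitting_def using n' xy by blast
    qed
    then show ?thesis by (intro exI)
  qed
  from chain[of i j] show ?thesis
    using *[of i j m m'] *[of j i m' m] by (elim disjE) (simp_all add: Int_commute)
qed

lemma eventually_fitting_filter:
  "eventually P fitting_filter \<longleftrightarrow> (\<exists>i m. \<forall>z\<in>fitting i m. P z)"
proof -
  have "eventually P fitting_filter \<longleftrightarrow>
      (\<exists>c\<in>UNIV. eventually P (case c of (i, m) \<Rightarrow> principal (fitting i m)))"
    unfolding fitting_filter_def
  proof (rule eventually_INF_base)
    fix c c' :: "'i \<times> nat"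
    obtain i m j m' where c: "c = (i, m)" "c' = (j, m')" by (cases c, cases c')
    obtain k l where "fitting k l \<subseteq> fitting i m \<inter> fitting j m'" using fitting_directed by blast
    then show "\<exists>x\<in>UNIV. (case x of (i, m) \<Rightarrow> principal (fitting i m))
        \<le> inf (case c of (i, m) \<Rightarrow> principal (fitting i m)) (case c' of (i, m) \<Rightarrow> principal (fitting i m))"
      unfolding c by (intro bexI[of _ "(k, l)"]) auto
  qed simp
  then show ?thesis
    by (auto simp: eventually_principal split: prod.splits)
qed

text \<open>Pairs in \<open>fitting i m\<close> have first coordinate at least \<open>a m\<close>;
  conversely every point from \<open>a m\<close> on has a partner in the same segment fitting the
  condition, so the projection of \<open>fitting i m\<close> is the whole tail.\<close>

lemma filtermap_fst_fitting_filter: "filtermap fst fitting_filter = at_top"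
proof (rule filter_eq_iff[THEN iffD2], intro allI iffI)
  fix P :: "'a \<Rightarrow> bool"
  assume "eventually P at_top"
  then obtain N where N: "\<And>x. x \<ge> N \<Longrightarrow> P x" by (auto simp: eventually_at_top_linorder)
  obtain m where m: "N \<le> a m" using A.cofinal by blast
  have "P x" if xy: "(x, y) \<in> fitting i m" for x y and i :: 'i
  proof -
    obtain n where "m \<le> n" "a n \<le> x" using xy by (auto simp: fitting_def)
    moreover from this have "a m \<le> a n" by simp
    ultimately show ?thesis using m by (intro N) (meson order_trans)
  qed
  then show "eventually P (filtermap fst fitting_filter)"
    unfolding eventually_filtermap eventually_fitting_filter by fastforce
next
  fix P :: "'a \<Rightarrow> bool"
  assume "eventually P (filtermap fst fitting_filter)"
  then obtain i m where im: "\<And>z. z \<in> fitting i m \<Longrightarrow> P (fst z)"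
    unfolding eventually_filtermap eventually_fitting_filter by blast
  have "P x" if x: "a m \<le> x" for x
  proof -
    obtain n where n: "m \<le> n" "x \<in> {a n..a (Suc n)}" using A.seg_exists[OF x] by blast
    obtain y where "y \<in> E \<inter> {b n..b (Suc n)}" "fits (H i n) x y"
      using fits_exists[OF B.ray_axioms matching n(2)] by blast
    then have "(x, y) \<in> fitting i m" using n by (auto simp: fitting_def)
    from im[OF this] show ?thesis by simp
  qed
  then show "eventually P at_top" by (auto simp: eventually_at_top_linorder)
qed

text \<open>The partitions of all segments are covered by one index \<open>i\<close>, and the
  interpolation error is bounded on every segment. The estimate therefore holds on all of
  \<open>fitting i 0\<close>.\<close>

lemma approximates_fitting_filter:
  "approximates fitting_filter (units_on {a 0..}) (units_on {b 0..})"
  unfolding approximates_def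
proof (intro ballI allI impI)
  fix f :: "'b \<Rightarrow> real" and \<epsilon> :: real
  assume f: "f \<in> units_on {b 0..}" and "0 < \<epsilon>"
  have cont: "continuous_on {b 0..} f"
    using f by (simp add: unit_functions_def continuous_map_in_subtopology)
  have unit: "f y \<in> {0..1}" if "b 0 \<le> y" for y
    using unit_functionsD[OF f, of y] that by simp
  have "\<exists>X. finite X \<and> X \<subseteq> E \<and> (\<forall>y z. b n \<le> y \<longrightarrow> y \<le> z \<longrightarrow> z \<le> b (Suc n) \<longrightarrow>
      (\<forall>e\<in>X. \<not> (y < e \<and> e < z)) \<longrightarrow> \<bar>f y - f z\<bar> \<le> \<epsilon>)" for n
    by (rule B.finite_oscillation_partition[OF cont \<open>0 < \<epsilon>\<close>, of "b n" "b (Suc n)"]) auto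
  then obtain X where X: "\<And>n. finite (X n)" "\<And>n. X n \<subseteq> E"
      "\<And>n y z. \<lbrakk>b n \<le> y; y \<le> z; z \<le> b (Suc n); \<forall>e\<in>X n. \<not> (y < e \<and> e < z)\<rbrakk> \<Longrightarrow> \<bar>f y - f z\<bar> \<le> \<epsilon>"
    by metis
  \<comment> \<open>A partition may contain points outside its segment. Only points strictly between
    two points of the segment matter, and these lie in it.\<close>
  have "\<exists>i. \<forall>n. X n \<inter> {b n..b (Suc n)} \<subseteq> Range (H i n)"
    using X(1,2) by (intro covers_Range) auto
  then obtain i where i: "\<And>n. X n \<inter> {b n..b (Suc n)} \<subseteq> Range (H i n)" by blast
  have b0: "b 0 \<le> y" if "b n \<le> y" for n y
    using that by (rule order_trans[rotated]) simp
  have "\<exists>g. continuous_on {a n..a (Suc n)} g \<and> g (a n) = f (b n) \<and> g (a (Suc n)) = f (b (Suc n)) \<and>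
      (\<forall>x\<in>{a n..a (Suc n)}. g x \<in> {0..1}) \<and>
      (\<forall>x\<in>{a n..a (Suc n)}. \<forall>y\<in>{b n..b (Suc n)}. fits (H i n) x y \<longrightarrow> \<bar>g x - f y\<bar> \<le> \<epsilon>)" for n
  proof (rule interpolation)
    have m: "finite (H i n)" "H i n \<subseteq> (D \<inter> {a n..a (Suc n)}) \<times> (E \<inter> {b n..b (Suc n)})"
        "(a n, b n) \<in> H i n" "(a (Suc n), b (Suc n)) \<in> H i n"
        "\<And>p q. p \<in> H i n \<Longrightarrow> q \<in> H i n \<Longrightarrow> fst p < fst q \<longleftrightarrow> snd p < snd q"
      using matching[of n i] unfolding matching_def by auto
    show "connected {a n..a (Suc n)}" by (rule A.connected_seg) simp
    show "a n \<le> a (Suc n)" by simp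
    show "a n \<le> fst p \<and> fst p \<le> a (Suc n)" if "p \<in> H i n" for p
      using m(2) that by auto
    show "finite (H i n)" "(a n, b n) \<in> H i n" "(a (Suc n), b (Suc n)) \<in> H i n" by fact+
    show "fst p < fst q \<longleftrightarrow> snd p < snd q" if "p \<in> H i n" "q \<in> H i n" for p q
      using m(5) that .
    show "f y \<in> {0..1}" if "b n \<le> y" for y
      using that by (intro unit b0)
    fix y z assume y: "b n \<le> y" "y \<le> z" "z \<le> b (Suc n)"
      and no: "\<forall>p\<in>H i n. \<not> (y < snd p \<and> snd p < z)"
    have "\<forall>e\<in>X n. \<not> (y < e \<and> e < z)"
    proof (intro ballI notI)
      fix e assume e: "e \<in> X n" "y < e \<and> e < z"
      then have "e \<in> {b n..b (Suc n)}" using y by auto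
      then obtain d where "(d, e) \<in> H i n" using i e(1) by blast
      then show False using no e(2) by auto
    qed
    then show "\<bar>f y - f z\<bar> \<le> \<epsilon>" by (rule X(3)[OF y])
  qed
  then obtain g where g: "\<And>n. continuous_on {a n..a (Suc n)} (g n)" "\<And>n. g n (a n) = f (b n)"
      "\<And>n. g n (a (Suc n)) = f (b (Suc n))" "\<And>n x. x \<in> {a n..a (Suc n)} \<Longrightarrow> g n x \<in> {0..1}"
      "\<And>n x y. \<lbrakk>x \<in> {a n..a (Suc n)}; y \<in> {b n..b (Suc n)}; fits (H i n) x y\<rbrakk> \<Longrightarrow> \<bar>g n x - f y\<bar> \<le> \<epsilon>"
    by metis
  \<comment> \<open>Adjacent pieces both take the value \<open>f (b (Suc n))\<close> at
    \<open>a (Suc n)\<close>, since the pair of cut points belongs to every matching.\<close>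
  obtain G where G: "continuous_on {a 0..} G" "\<And>n x. x \<in> {a n..a (Suc n)} \<Longrightarrow> G x = g n x"
    using A.continuous_on_ray_glue[of g] g(1-3) by metis
  let ?G = "restrict G {a 0..}"
  have "G x \<in> {0..1}" if x: "a 0 \<le> x" for x
  proof -
    obtain n where "x \<in> {a n..a (Suc n)}" using A.seg_exists[OF x] by blast
    then show ?thesis using g(4) G(2) by simp
  qed
  then have "?G \<in> units_on {a 0..}"
    using G(1) by (intro restrict_mem_unit_functions) auto
  moreover have "\<bar>?G (fst z) - f (snd z)\<bar> \<le> \<epsilon>" if zf: "z \<in> fitting i 0" for z
  proof -
    obtain x y n where z: "z = (x, y)" "x \<in> {a n..a (Suc n)}" "y \<in> {b n..b (Suc n)}" "fits (H i n) x y"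
      using zf unfolding fitting_def by blast
    have "a 0 \<le> a n" by simp
    then have "a 0 \<le> x" using z(2) by (meson atLeastAtMost_iff order_trans)
    then show ?thesis using z G(2)[OF z(2)] g(5)[OF z(2-4)] by simp
  qed
  ultimately show "\<exists>g\<in>units_on {a 0..}. \<forall>\<^sub>F z in fitting_filter. \<bar>g (fst z) - f (snd z)\<bar> \<le> \<epsilon>"
    unfolding eventually_fitting_filter by blast
qed

interpretation C: interlacing b E a D "\<lambda>i n. (H i n)\<inverse>"
  by (rule interlacing_converse)

lemma filtermap_swap_fitting_filter: "filtermap prod.swap fitting_filter = C.fitting_filter"
proof (rule filter_eq_iff[THEN iffD2], intro allI)
  have "C.fitting i m = prod.swap ` fitting i m" for i m
    unfolding C.fitting_def fitting_def fits_converse by (force simp: image_iff)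
  then show "eventually P (filtermap prod.swap fitting_filter) \<longleftrightarrow> eventually P C.fitting_filter" for P
    by (simp add: eventually_filtermap C.eventually_fitting_filter eventually_fitting_filter)
qed

text \<open>Swapping coordinates turns the filter into that of the converse interlacing, which
  supplies the second projection and the approximation in the other direction.\<close>

theorem remainders_homeomorphic:
  "cech_stone_remainder (top_of_set {a 0..}) homeomorphic_space cech_stone_remainder (top_of_set {b 0..})"
proof -
  have "filtermap snd fitting_filter = filtermap fst (filtermap prod.swap fitting_filter)"
    by (simp add: filtermap_filtermap)
  then have snd: "filtermap snd fitting_filter = at_top"
    by (simp add: filtermap_swap_fitting_filter C.filtermap_fst_fitting_filter)
  have "\<forall>\<^sub>F x in at_top. x \<in> {a 0..}" "\<forall>\<^sub>F y in at_top. y \<in> {b 0..}"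
    by (simp_all add: eventually_ge_at_top)
  then show ?thesis
    unfolding cech_stone_remainder_ray[OF A.connected_ray A.unbounded]
      cech_stone_remainder_ray[OF B.connected_ray B.unbounded]
    using C.approximates_fitting_filter
    by (intro homeomorphic_tail_limits[OF filtermap_fst_fitting_filter snd approximates_fitting_filter])
      (simp_all add: filtermap_swap_fitting_filter)
qed

end

section \<open>Rays of weight continuum\<close>

text \<open>Size at most continuum is expressed by the maps \<delta> and \<eta> from
  \<open>nat set\<close>, so that sets of naturals index points, finite sequences of points and
  stages alike. One code is read through both maps: stage \<open>A\<close> puts the decoded points
  into the domain and into the range.\<close>

lemma rays_remainders_homeomorphic:
  fixes \<delta> :: "nat set \<Rightarrow> 'a::linorder_topology" and \<eta> :: "nat set \<Rightarrow> 'b::linorder_topology"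
  assumes CH: "Continuum_Hypothesis" and rays: "ray a D" "ray b E"
    and D: "D \<subseteq> range \<delta>" and E: "E \<subseteq> range \<eta>"
  shows "cech_stone_remainder (top_of_set {a 0..}) homeomorphic_space cech_stone_remainder (top_of_set {b 0..})"
proof -
  \<comment> \<open>A code may name points outside \<open>D\<close>, outside \<open>E\<close> or in
    the wrong segment; the intersections discard them and keep the task solvable.\<close>
  let ?Q = "\<lambda>A n s. \<delta> ` decode A n \<inter> (D \<inter> {a n..a (Suc n)}) \<subseteq> Domain s \<and>
    \<eta> ` decode A n \<inter> (E \<inter> {b n..b (Suc n)}) \<subseteq> Range s"
  have ext: "\<exists>t. s \<subseteq> t \<and> matching a D b E n t \<and> ?Q A n t" if s: "matching a D b E n s" for A n s
  proof -
    obtain t where t: "s \<subseteq> t" "matching a D b E n t"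
        "\<delta> ` decode A n \<inter> (D \<inter> {a n..a (Suc n)}) \<subseteq> Domain t"
      using matching_extend_Domain[OF rays(2) s, of "\<delta> ` decode A n \<inter> (D \<inter> {a n..a (Suc n)})"]
      by (auto simp: finite_decode)
    obtain t' where "t \<subseteq> t'" "matching a D b E n t'"
        "\<eta> ` decode A n \<inter> (E \<inter> {b n..b (Suc n)}) \<subseteq> Range t'"
      using matching_extend_Range[OF rays(1) t(2), of "\<eta> ` decode A n \<inter> (E \<inter> {b n..b (Suc n)})"]
      by (auto simp: finite_decode)
    then show ?thesis using t(1,3) by (intro exI[of _ t']) blast
  qed
  have base: "\<exists>s. matching a D b E n s" for n
    using matching_base[OF rays] by blast
  obtain H where H: "\<And>A n. matching a D b E n (H A n)" "\<And>A n. ?Q A n (H A n)"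
    "\<And>A B. (\<forall>\<^sub>F n in sequentially. H A n \<subseteq> H B n) \<or> (\<forall>\<^sub>F n in sequentially. H B n \<subseteq> H A n)"
    by (rule CH_chain_exists[where M = "matching a D b E" and Q = ?Q, OF CH base ext];
        (assumption | (rule that; assumption)))
  have coded: "\<exists>A. \<forall>n. f ` decode A n = X n" if X: "\<And>n. finite (X n)" "\<And>n. X n \<subseteq> range f"
    for f :: "nat set \<Rightarrow> 'c" and X
  proof -
    have "\<forall>n. \<exists>F. finite F \<and> X n = f ` F"
      using finite_subset_image[OF X] by blast
    then obtain F where F: "\<And>n. finite (F n)" "\<And>n. X n = f ` F n" by metis
    obtain A where "\<And>n. decode A n = F n" using decode_surj[of F] F(1) by blast
    then show ?thesis using F(2) by (intro exI[of _ A]) simp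
  qed
  have "interlacing a D b E H"
  proof (intro interlacing.intro rays interlacing_axioms.intro H(1,3))
    fix X :: "nat \<Rightarrow> 'a set" assume X: "\<And>n. finite (X n)" "\<And>n. X n \<subseteq> D \<inter> {a n..a (Suc n)}"
    then obtain A where A: "\<And>n. \<delta> ` decode A n = X n" using coded[of X \<delta>] D by blast
    have "X n \<subseteq> Domain (H A n)" for n
      using H(2)[of A n] X(2)[of n] by (simp add: A inf_absorb1)
    then show "\<exists>i. \<forall>n. X n \<subseteq> Domain (H i n)" by blast
  next
    fix Y :: "nat \<Rightarrow> 'b set" assume Y: "\<And>n. finite (Y n)" "\<And>n. Y n \<subseteq> E \<inter> {b n..b (Suc n)}"
    then obtain A where A: "\<And>n. \<eta> ` decode A n = Y n" using coded[of Y \<eta>] E by blast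
    have "Y n \<subseteq> Range (H A n)" for n
      using H(2)[of A n] Y(2)[of n] by (simp add: A inf_absorb1)
    then show "\<exists>i. \<forall>n. Y n \<subseteq> Range (H i n)" by blast
  qed
  then show ?thesis by (rule interlacing.remainders_homeomorphic)
qed

text \<open>The cut points outrun an enumeration of a countable cofinal set. Picking a point in each
  member of a base gives a dense set, because connectedness makes every interval
  \<open>{x<..<y}\<close> with \<open>x < y\<close> nonempty.\<close>

lemma ray_of_weight_continuum:
  fixes m :: "'a::linorder_topology"
  assumes conn: "connected (UNIV :: 'a set)"
    and least: "\<And>x::'a. m \<le> x" and unb: "\<not> (\<exists>b::'a. \<forall>x. x \<le> b)"
    and cof: "countable_cofinality TYPE('a)"
    and weight: "has_weight (euclidean :: 'a topology) continuum"
  obtains a :: "nat \<Rightarrow> 'a" and \<delta> :: "nat set \<Rightarrow> 'a" where "ray a (range \<delta>)" "a 0 = m"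
proof -
  obtain C :: "'a set" where C: "countable C" "\<And>x. \<exists>c\<in>C. x \<le> c"
    using cof by (auto simp: countable_cofinality_def)
  define e where "e = from_nat_into C"
  have "C \<noteq> {}" using C(2) by blast
  then have e: "range e = C" unfolding e_def using C(1) by (rule range_from_nat_into)
  have "\<forall>x::'a. \<exists>y. x < y" using unb by (simp add: not_le)
  then obtain nx :: "'a \<Rightarrow> 'a" where nx: "\<And>x. x < nx x" by metis
  define a where "a = rec_nat m (\<lambda>n x. nx (max x (e n)))"
  have a_Suc: "max (a n) (e n) < a (Suc n)" for n
    using nx by (simp add: a_def)
  then have mono: "strict_mono a" by (simp add: strict_mono_Suc_iff)
  have cofinal: "\<exists>n. x \<le> a n" for x
  proof -
    obtain n where "x \<le> e n" using C(2)[of x] e by (metis imageE)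
    also have "e n < a (Suc n)" using a_Suc[of n] by simp
    finally show ?thesis by (intro exI[of _ "Suc n"] less_imp_le)
  qed
  obtain B where B: "topology_base (euclidean :: 'a topology) B" "|B| =o continuum"
    using weight by (auto simp: has_weight_def)
  have "card_of (UNIV :: nat set set) =o card_of B"
    using ordIso_symmetric[OF B(2)] by (simp add: continuum_def)
  then obtain \<psi> where \<psi>: "bij_betw \<psi> (UNIV :: nat set set) B"
    by (auto simp: card_of_ordIso[symmetric])
  \<comment> \<open>Membership of 0 is a flag: with it, the rest of \<open>A\<close>, shifted down,
    codes a basic open set; without it, \<open>A\<close> codes a cut point by its cardinality. An
    empty basic set yields an arbitrary point, which does no harm.\<close>
  define \<delta> where "\<delta> A = (if 0 \<in> A then SOME x. x \<in> \<psi> {k. Suc k \<in> A} else a (card A))" for A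
  have \<delta>_base: "(SOME x. x \<in> U) \<in> range \<delta>" if U: "U \<in> B" for U
  proof -
    obtain A where "U = \<psi> A" using \<psi> U by (auto simp: bij_betw_def)
    then have "(SOME x. x \<in> U) = \<delta> (insert 0 (Suc ` A))" by (simp add: \<delta>_def image_iff)
    then show ?thesis by simp
  qed
  have \<delta>_a: "a n \<in> range \<delta>" for n
  proof -
    \<comment> \<open>The set \<open>{1..n}\<close> has \<open>n\<close> elements and avoids the
      flag 0.\<close>
    have "a n = \<delta> {1..n}" by (simp add: \<delta>_def)
    then show ?thesis by (rule range_eqI)
  qed
  have dense: "\<exists>d\<in>range \<delta>. x < d \<and> d < y" if xy: "x < y" for x y
  proof -
    have "{x<..<y} \<noteq> {}"
    proof
      assume "{x<..<y} = {}"
      then have "{..<y} \<inter> {x<..} \<inter> UNIV = {}" "UNIV \<subseteq> {..<y} \<union> {x<..}"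
        using xy by auto
      then have "{..<y} \<inter> UNIV = {} \<or> {x<..} \<inter> UNIV = {}"
        by (intro connectedD[OF conn]) auto
      then show False using xy by auto
    qed
    then obtain z where z: "z \<in> {x<..<y}" by blast
    have "openin euclidean {x<..<y}" by simp
    then have "(arbitrary union_of (\<lambda>U. U \<in> B)) {x<..<y}"
      using B(1) by (simp add: topology_base_def)
    then obtain \<U> where \<U>: "\<U> \<subseteq> B" "\<Union>\<U> = {x<..<y}"
      by (auto simp: union_of_def)
    then obtain U where U: "U \<in> \<U>" "z \<in> U" using z by blast
    then have "(SOME x. x \<in> U) \<in> U" by (intro someI)
    then have "(SOME x. x \<in> U) \<in> {x<..<y}" using U(1) \<U>(2) by blast
    moreover have "(SOME x. x \<in> U) \<in> range \<delta>" using U(1) \<U>(1) by (intro \<delta>_base) blast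
    ultimately show ?thesis by (intro bexI[of _ "SOME x. x \<in> U"]) simp_all
  qed
  have "a 0 = m" by (simp add: a_def)
  moreover from this have "{a 0..} = UNIV" using least by auto
  then have "ray a (range \<delta>)"
    using conn mono cofinal \<delta>_a dense by unfold_locales auto
  ultimately show ?thesis using that by blast
qed

section \<open>The half line, cut at the naturals, with the rationals as dense set\<close>

lemma ray_real: "ray real \<rat>"
proof
  show "connected {real 0..}" by simp
  show "strict_mono real" by (simp add: strict_mono_def)
  show "\<exists>n. x \<le> real n" for x by (rule real_arch_simple)
  show "real n \<in> \<rat>" for n by simp
  show "\<exists>d\<in>\<rat>. x < d \<and> d < y" if "x < y" for x y :: real
    using Rats_dense_in_real[OF that] by blast
qed

lemma Rats_subset_range: "(\<rat> :: real set) \<subseteq> range (\<lambda>A :: nat set. from_nat_into \<rat> (card A))"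
proof
  fix x :: real assume "x \<in> \<rat>"
  then obtain n where "x = from_nat_into \<rat> n"
    using from_nat_into_surj[OF countable_rat] by metis
  then have "x = from_nat_into \<rat> (card {..<n})" by simp
  then show "x \<in> range (\<lambda>A :: nat set. from_nat_into \<rat> (card A))" by (rule range_eqI)
qed

theorem theorem2p1:
  assumes "Continuum_Hypothesis"
    and "connected (UNIV :: 'a::linorder_topology set)"
    and "\<exists>a::'a. \<forall>x. a \<le> x"
    and "\<not> (\<exists>b::'a. \<forall>x. x \<le> b)"
    and "countable_cofinality TYPE('a)"
    and "has_weight (euclidean :: 'a topology) continuum"
  shows "cech_stone_remainder (euclidean :: 'a topology)
           homeomorphic_space cech_stone_remainder (top_of_set {0::real..})"
proof -
  obtain m :: 'a where m: "\<And>x. m \<le> x" using assms(3) by blast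
  obtain a :: "nat \<Rightarrow> 'a" and \<delta> :: "nat set \<Rightarrow> 'a" where a: "ray a (range \<delta>)" "a 0 = m"
    using ray_of_weight_continuum[OF assms(2) m assms(4-6)] by blast
  \<comment> \<open>As \<open>a 0\<close> is the first element, the ray is the whole space and its
    subspace topology is the given one.\<close>
  have "{a 0..} = UNIV" using m a(2) by auto
  then show ?thesis
    using rays_remainders_homeomorphic[OF assms(1) a(1) ray_real subset_refl Rats_subset_range]
    by simp
qed

end
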